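(* Let $\Phi_1$ and $\Phi_2$ be $N$-functions with complementary $N$-functions $\Psi_1$ and $\Psi_2$ respectively. Suppose that $$\int_0^1\frac{\Psi_1(v)}{v^2}\,dv<\infty,\qquad \int_0^1\frac{\Psi_2(v)}{v^2}\,dv<\infty,\qquad \int_0^1\frac{\Phi_2(v)}{v^2}\,dv<\infty.$$ Then $$\dim\,\overline H^1_{\Phi_1,\Phi_2}(\mathbb{H}^2)=\infty.$$
   Context: An $N$-function is a function $\Phi:\mathbb{R}\to[0,\infty)$ that is even and convex, with $\Phi(x)=0\iff x=0$, $\lim_{x\to0}\Phi(x)/x=0$ and $\lim_{x\to\infty}\Phi(x)/x=\infty$. Its complementary $N$-function is $\Psi(y)=\sup\{x|y|-\Phi(x):x\ge0\}$, $y\in\mathbb{R}$. The hyperbolic plane $\mathbb{H}^2$ is the Riemannian manifold $\mathbb{R}^2$ with coordinates $(y,z)$ and Riemannian metric $ds^2=e^{2z}dy^2+dz^2$. For a Riemannian manifold $X$ of dimension $n$ with volume element $d\mu_X$, and a measurable $k$-form $\omega$ on $X$ with pointwise norm $|\omega(x)|$ (induced by the Riemannian scalar product on exterior forms on $T_xX$), put $\rho_\Phi(\omega)=\int_X\Phi(|\omega(x)|)\,d\mu_X$. Forms differing on a set of measure zero are identified. $L^\Phi(X,\Lambda^k)$ is the space of measurable $k$-forms $\omega$ with $\rho_\Phi(\alpha\omega)<\infty$ for some $\alpha>0$, endowed with the gauge norm $\|\omega\|_{(\Phi)}=\inf\{K>0:\rho_\Phi(\omega/K)\le1\}$; it is a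 Banach space. Weak differential: a locally integrable $(j+1)$-form $\theta$ is the (weak) differential $d\omega$ of a locally integrable $j$-form $\omega$ if $\int_U\omega\wedge du=(-1)^{j+1}\int_U\theta\wedge u$ for every orientable domain $U\subset\mathrm{Int}\,X$ and every smooth compactly supported $(n-j-1)$-form $u$ with support in $U$. $Z^k_{\Phi_2}(X)=\{\omega\in L^{\Phi_2}(X,\Lambda^k): d\omega=0\}$; $B^k_{\Phi_1,\Phi_2}(X)=\{\omega\in L^{\Phi_2}(X,\Lambda^k):\omega=d\beta\text{ for some }\beta\in L^{\Phi_1}(X,\Lambda^{k-1})\}$; $\overline B^k_{\Phi_1,\Phi_2}(X)$ is the closure of $B^k_{\Phi_1,\Phi_2}(X)$ in $L^{\Phi_2}(X,\Lambda^k)$. The reduced $L_{\Phi_1,\Phi_2}$-cohomology is $\overline H^k_{\Phi_1,\Phi_2}(X)=Z^k_{\Phi_2}(X)/\overline B^k_{\Phi_1,\Phi_2}(X)$. *)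

theory Defs
  imports "HOL-Analysis.Analysis" "HOL-Algebra.AbelCoset" "Jordan_Normal_Form.Missing_VectorSpace"
begin

section \<open>N-functions\<close>

definition N_function :: "(real \<Rightarrow> real) \<Rightarrow> bool" where
  "N_function \<Phi> \<longleftrightarrow>
     (\<forall>x. 0 \<le> \<Phi> x) \<and> (\<forall>x. \<Phi> (- x) = \<Phi> x) \<and> convex_on UNIV \<Phi> \<and>
     (\<forall>x. \<Phi> x = 0 \<longleftrightarrow> x = 0) \<and>
     ((\<lambda>x. \<Phi> x / x) \<longlongrightarrow> 0) (at 0) \<and>
     filterlim (\<lambda>x. \<Phi> x / x) at_top at_top"

text \<open>The supremum is finite for every N-function, because \<open>\<Phi> x / x\<close> tends to infinity.\<close>
definition complementary :: "(real \<Rightarrow> real) \<Rightarrow> real \<Rightarrow> real" where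
  "complementary \<Phi> y = (SUP x\<in>{0..}. x * \<bar>y\<bar> - \<Phi> x)"

section \<open>Orlicz spaces of measurable fields\<close>

text \<open>
  A field assigns to each point a value in a fixed coefficient space \<open>'v\<close>; \<open>\<nu> p\<close> is the
  pointwise norm at \<open>p\<close>. Borel measurable representatives are used. Forms that agree almost
  everywhere are not identified here: they have gauge distance 0, so they are identified in the
  quotient by a closed subspace below.
\<close>
definition modular ::
  "'a measure \<Rightarrow> ('a \<Rightarrow> 'v \<Rightarrow> real) \<Rightarrow> (real \<Rightarrow> real) \<Rightarrow> ('a \<Rightarrow> 'v) \<Rightarrow> ennreal" where
  "modular M \<nu> \<Phi> \<omega> = (\<integral>\<^sup>+p. ennreal (\<Phi> (\<nu> p (\<omega> p))) \<partial>M)"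

definition orlicz_space ::
  "'a measure \<Rightarrow> ('a \<Rightarrow> 'v::real_normed_vector \<Rightarrow> real) \<Rightarrow> (real \<Rightarrow> real) \<Rightarrow> ('a \<Rightarrow> 'v) set" where
  "orlicz_space M \<nu> \<Phi> =
     {\<omega> \<in> borel_measurable M. \<exists>\<alpha>>0. modular M \<nu> \<Phi> (\<lambda>p. \<alpha> *\<^sub>R \<omega> p) < \<infinity>}"

definition gauge_norm ::
  "'a measure \<Rightarrow> ('a \<Rightarrow> 'v::real_normed_vector \<Rightarrow> real) \<Rightarrow> (real \<Rightarrow> real) \<Rightarrow> ('a \<Rightarrow> 'v) \<Rightarrow> real" where
  "gauge_norm M \<nu> \<Phi> \<omega> = Inf {K. 0 < K \<and> modular M \<nu> \<Phi> (\<lambda>p. \<omega> p /\<^sub>R K) \<le> 1}"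

section \<open>Riemannian metrics on the coordinate plane\<close>

text \<open>
  Points and tangent vectors are coordinate pairs. A covector \<open>a dy + b dz\<close> is the pair
  \<open>(a, b)\<close>, acting on tangent vectors by \<open>\<bullet>\<close>. Accordingly a 0-form is a function, a 1-form
  \<open>a dy + b dz\<close> is a map into pairs, and a 2-form \<open>h dy \<and> dz\<close> is given by the function \<open>h\<close>.
\<close>
type_synonym plane = "real \<times> real"
type_synonym metric = "plane \<Rightarrow> plane \<Rightarrow> plane \<Rightarrow> real"

definition sharp :: "metric \<Rightarrow> plane \<Rightarrow> plane \<Rightarrow> plane" where
  "sharp g p \<alpha> = (THE v. \<forall>w. g p v w = \<alpha> \<bullet> w)"

definition form_norm0 :: "plane \<Rightarrow> real \<Rightarrow> real" where
  "form_norm0 p x = \<bar>x\<bar>"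

definition form_norm1 :: "metric \<Rightarrow> plane \<Rightarrow> plane \<Rightarrow> real" where
  "form_norm1 g p \<alpha> = sqrt (g p (sharp g p \<alpha>) (sharp g p \<alpha>))"

definition riemannian_measure :: "metric \<Rightarrow> plane measure" where
  "riemannian_measure g = density lborel
     (\<lambda>p. ennreal (sqrt (g p (1,0) (1,0) * g p (0,1) (0,1) - (g p (1,0) (0,1))\<^sup>2)))"

definition hyperbolic_metric :: metric where
  "hyperbolic_metric p v w = exp (2 * snd p) * fst v * fst w + snd v * snd w"

section \<open>Smooth forms and weak differentials\<close>

primrec Ck :: "nat \<Rightarrow> ('a::real_normed_vector \<Rightarrow> 'b::real_normed_vector) \<Rightarrow> bool" where
  "Ck 0 f \<longleftrightarrow> continuous_on UNIV f"
| "Ck (Suc k) f \<longleftrightarrow> f differentiable_on UNIV \<and> (\<forall>v. Ck k (\<lambda>x. frechet_derivative f (at x) v))"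

definition smooth :: "('a::real_normed_vector \<Rightarrow> 'b::real_normed_vector) \<Rightarrow> bool" where
  "smooth f \<longleftrightarrow> (\<forall>k. Ck k f)"

definition test_form :: "plane set \<Rightarrow> (plane \<Rightarrow> 'v::real_normed_vector) \<Rightarrow> bool" where
  "test_form U u \<longleftrightarrow>
     smooth u \<and> compact (closure {p. u p \<noteq> 0}) \<and> closure {p. u p \<noteq> 0} \<subseteq> U"

definition d0 :: "(plane \<Rightarrow> real) \<Rightarrow> plane \<Rightarrow> plane" where
  "d0 u p = (frechet_derivative u (at p) (1,0), frechet_derivative u (at p) (0,1))"

definition d1 :: "(plane \<Rightarrow> plane) \<Rightarrow> plane \<Rightarrow> real" where
  "d1 u p = frechet_derivative (\<lambda>q. snd (u q)) (at p) (1,0)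
          - frechet_derivative (\<lambda>q. fst (u q)) (at p) (0,1)"

definition wedge11 :: "plane \<Rightarrow> plane \<Rightarrow> real" where
  "wedge11 \<alpha> \<beta> = fst \<alpha> * snd \<beta> - snd \<alpha> * fst \<beta>"

text \<open>
  A smooth metric has a volume density that is bounded above and below on compact sets, so local
  integrability of a form with respect to it is local integrability of the coefficients.
\<close>
definition locally_integrable ::
  "(plane \<Rightarrow> 'v::{banach, second_countable_topology}) \<Rightarrow> bool" where
  "locally_integrable \<omega> \<longleftrightarrow> (\<forall>K. compact K \<longrightarrow> set_integrable lborel K \<omega>)"

text \<open>
  The weak differential of a \<open>j\<close>-form for \<open>j = 0\<close> and \<open>j = 1\<close>; the sign is \<open>(-1)^(j+1)\<close> and
  the integral of \<open>h dy \<and> dz\<close> is the Lebesgue integral of \<open>h\<close>. Every domain in the plane is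
  orientable, and reversing the orientation changes the sign of both integrals.
\<close>
definition weak_differential0 :: "(plane \<Rightarrow> real) \<Rightarrow> (plane \<Rightarrow> plane) \<Rightarrow> bool" where
  "weak_differential0 \<beta> \<theta> \<longleftrightarrow> locally_integrable \<beta> \<and> locally_integrable \<theta> \<and>
     (\<forall>U. open U \<and> connected U \<longrightarrow> (\<forall>u. test_form U u \<longrightarrow>
        (LINT p:U|lborel. \<beta> p * d1 u p) = - (LINT p:U|lborel. wedge11 (\<theta> p) (u p))))"

definition weak_differential1 :: "(plane \<Rightarrow> plane) \<Rightarrow> (plane \<Rightarrow> real) \<Rightarrow> bool" where
  "weak_differential1 \<omega> \<theta> \<longleftrightarrow> locally_integrable \<omega> \<and> locally_integrable \<theta> \<and>
     (\<forall>U. open U \<and> connected U \<longrightarrow> (\<forall>u. test_form U u \<longrightarrow>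
        (LINT p:U|lborel. wedge11 (\<omega> p) (d0 u p)) = (LINT p:U|lborel. \<theta> p * u p)))"

section \<open>Reduced Orlicz cohomology in degree one\<close>

definition L0 :: "metric \<Rightarrow> (real \<Rightarrow> real) \<Rightarrow> (plane \<Rightarrow> real) set" where
  "L0 g \<Phi> = orlicz_space (riemannian_measure g) form_norm0 \<Phi>"

definition L1 :: "metric \<Rightarrow> (real \<Rightarrow> real) \<Rightarrow> (plane \<Rightarrow> plane) set" where
  "L1 g \<Phi> = orlicz_space (riemannian_measure g) (form_norm1 g) \<Phi>"

definition Z1 :: "metric \<Rightarrow> (real \<Rightarrow> real) \<Rightarrow> (plane \<Rightarrow> plane) set" where
  "Z1 g \<Phi>2 = {\<omega> \<in> L1 g \<Phi>2. weak_differential1 \<omega> (\<lambda>_. 0)}"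

definition B1 :: "metric \<Rightarrow> (real \<Rightarrow> real) \<Rightarrow> (real \<Rightarrow> real) \<Rightarrow> (plane \<Rightarrow> plane) set" where
  "B1 g \<Phi>1 \<Phi>2 = {\<omega> \<in> L1 g \<Phi>2. \<exists>\<beta>\<in>L0 g \<Phi>1. weak_differential0 \<beta> \<omega>}"

definition B1_closure :: "metric \<Rightarrow> (real \<Rightarrow> real) \<Rightarrow> (real \<Rightarrow> real) \<Rightarrow> (plane \<Rightarrow> plane) set" where
  "B1_closure g \<Phi>1 \<Phi>2 = {\<omega> \<in> L1 g \<Phi>2. \<forall>\<epsilon>>0. \<exists>\<eta>\<in>B1 g \<Phi>1 \<Phi>2.
     gauge_norm (riemannian_measure g) (form_norm1 g) \<Phi>2 (\<lambda>p. \<omega> p - \<eta> p) < \<epsilon>}"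

text \<open>
  The fields \<open>mult\<close> and \<open>one\<close> of a \<open>module\<close> record play no role in \<open>vectorspace\<close>.
\<close>
definition real_field :: "real ring" where
  "real_field = \<lparr>carrier = UNIV, mult = (*), one = 1, zero = 0, add = (+)\<rparr>"

definition function_module :: "('a \<Rightarrow> 'v::real_vector) set \<Rightarrow> (real, 'a \<Rightarrow> 'v) module" where
  "function_module S =
     \<lparr>carrier = S, mult = undefined, one = undefined,
      zero = (\<lambda>_. 0), add = (\<lambda>f h p. f p + h p), smult = (\<lambda>c f p. c *\<^sub>R f p)\<rparr>"

definition quotient_module :: "('r, 'm, 'x) module_scheme \<Rightarrow> 'm set \<Rightarrow> ('r, 'm set) module" where
  "quotient_module V W =
     \<lparr>carrier = a_rcosets\<^bsub>V\<^esub> W, mult = undefined, one = undefined,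
      zero = W, add = (\<lambda>C D. C <+>\<^bsub>V\<^esub> D), smult = (\<lambda>c C. \<Union>x\<in>C. W +>\<^bsub>V\<^esub> (c \<odot>\<^bsub>V\<^esub> x))\<rparr>"

definition reduced_cohomology1 ::
  "metric \<Rightarrow> (real \<Rightarrow> real) \<Rightarrow> (real \<Rightarrow> real) \<Rightarrow> (real, (plane \<Rightarrow> plane) set) module" where
  "reduced_cohomology1 g \<Phi>1 \<Phi>2 =
     quotient_module (function_module (Z1 g \<Phi>2)) (B1_closure g \<Phi>1 \<Phi>2)"

section \<open>The reduced cohomology is a real vector space\<close>

text \<open>
  The dimension notions of the locale \<open>vectorspace\<close> only make sense for records that satisfy its
  axioms, so we check them for the quotient of the hyperbolic plane.
\<close>


definition lin_closed :: "('a \<Rightarrow> 'v::real_vector) set \<Rightarrow> bool" where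
  "lin_closed S \<longleftrightarrow> (\<lambda>_. 0) \<in> S \<and> (\<forall>f\<in>S. \<forall>h\<in>S. (\<lambda>p. f p + h p) \<in> S) \<and> (\<forall>c. \<forall>f\<in>S. (\<lambda>p. c *\<^sub>R f p) \<in> S)"

lemma lin_add: "lin_closed S \<Longrightarrow> f \<in> S \<Longrightarrow> h \<in> S \<Longrightarrow> (\<lambda>p. f p + h p) \<in> S" unfolding lin_closed_def by blast
lemma lin_smult: "lin_closed S \<Longrightarrow> f \<in> S \<Longrightarrow> (\<lambda>p. c *\<^sub>R f p) \<in> S" unfolding lin_closed_def by blast

lemma field_real_field: "field real_field"
proof -
  have ag: "abelian_group real_field"
    by (rule abelian_groupI) (auto simp: real_field_def algebra_simps intro: exI[of _ "- x" for x])
  have cm: "Group.comm_monoid real_field"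
    by (rule comm_monoidI) (auto simp: real_field_def algebra_simps)
  interpret cring real_field
    by (rule cringI[OF ag cm]) (auto simp: real_field_def algebra_simps)
  show ?thesis
    by (rule cring_fieldI2) (auto simp: real_field_def intro: right_inverse)
qed

lemma coset_eq: "a_r_coset (function_module S) W x = {\<lambda>p. h p + x p |h. h \<in> W}"
  by (auto simp: a_r_coset_def' function_module_def)

lemma setadd: "set_add (function_module S) C D = {\<lambda>p. h p + x p |h x. h \<in> C \<and> x \<in> D}"
  by (auto simp: set_add_def' function_module_def)

lemma in_coset: "lin_closed W \<Longrightarrow> y \<in> a_r_coset (function_module S) W x \<longleftrightarrow> (\<lambda>p. y p - x p) \<in> W"
  unfolding coset_eq by (auto intro!: exI[of _ "\<lambda>p. y p - x p"])

lemma coset_add: assumes "lin_closed W"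
  shows "set_add (function_module S) (a_r_coset (function_module S) W x) (a_r_coset (function_module S) W y)
    = a_r_coset (function_module S) W (\<lambda>p. x p + y p)" (is "?A = ?B")
proof (intro equalityI subsetI)
  fix z assume "z \<in> ?A"
  then obtain h k where h: "h \<in> W" "k \<in> W" "z = (\<lambda>p. (h p + x p) + (k p + y p))"
    unfolding setadd coset_eq by auto
  have "(\<lambda>p. h p + k p) \<in> W" using assms h unfolding lin_closed_def by blast
  then show "z \<in> ?B" unfolding in_coset[OF assms] h by (simp add: algebra_simps)
next
  fix z assume "z \<in> ?B"
  then have "(\<lambda>p. z p - (x p + y p)) \<in> W" unfolding in_coset[OF assms] .
  then have "(\<lambda>p. z p - y p) \<in> a_r_coset (function_module S) W x" "y \<in> a_r_coset (function_module S) W y"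
    using assms unfolding in_coset[OF assms] by (auto simp: algebra_simps lin_closed_def)
  moreover have "z = (\<lambda>p. (z p - y p) + y p)" by simp
  ultimately show "z \<in> ?A" unfolding setadd mem_Collect_eq by (intro exI conjI)
qed

lemma coset_smult: assumes "lin_closed W"
  shows "(\<Union>z\<in>a_r_coset (function_module S) W x. a_r_coset (function_module S) W (\<lambda>p. c *\<^sub>R z p))
    = a_r_coset (function_module S) W (\<lambda>p. c *\<^sub>R x p)" (is "?A = ?B")
proof (intro equalityI subsetI)
  fix y assume "y \<in> ?A"
  then obtain z where z: "(\<lambda>p. z p - x p) \<in> W" "(\<lambda>p. y p - c *\<^sub>R z p) \<in> W"
    unfolding UN_iff in_coset[OF assms] using in_coset[OF assms, of _ S x] by blast
  then have "(\<lambda>p. (y p - c *\<^sub>R z p) + c *\<^sub>R (z p - x p)) \<in> W" using lin_add[OF assms z(2) lin_smult[OF assms z(1)]] by simp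
  then show "y \<in> ?B" unfolding in_coset[OF assms] by (simp add: algebra_simps)
next
  fix y assume "y \<in> ?B"
  moreover have "x \<in> a_r_coset (function_module S) W x" using assms unfolding in_coset[OF assms] by (simp add: lin_closed_def)
  ultimately show "y \<in> ?A" by blast
qed

lemma vs_quot: fixes Z W :: "('a \<Rightarrow> 'v::real_vector) set"
  assumes Z: "lin_closed Z" and W: "lin_closed W"
  shows "vectorspace real_field (quotient_module (function_module Z) W)"
proof -
  let ?F = "function_module Z" let ?Q = "quotient_module ?F W"
  define q where "q x = a_r_coset ?F W x" for x
  have car: "carrier ?Q = q ` Z"
    unfolding quotient_module_def q_def by (auto simp: A_RCOSETS_def' function_module_def)
  have ad: "add ?Q (q x) (q y) = q (\<lambda>p. x p + y p)" for x y
    using coset_add[OF W, of Z x y] by (simp add: q_def quotient_module_def)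
  have sm: "smult ?Q c (q x) = q (\<lambda>p. c *\<^sub>R x p)" for x c
    using coset_smult[OF W, where S=Z and x=x and c=c] by (simp add: q_def quotient_module_def) (simp add: function_module_def)
  have ze: "zero ?Q = q (\<lambda>_. 0)"
    unfolding q_def coset_eq by (simp add: quotient_module_def)
  have Zc: "(\<lambda>p. 0) \<in> Z" "x \<in> Z \<Longrightarrow> y \<in> Z \<Longrightarrow> (\<lambda>p. x p + y p) \<in> Z" "x \<in> Z \<Longrightarrow> (\<lambda>p. c *\<^sub>R x p) \<in> Z" for x y and c :: real
    using Z unfolding lin_closed_def by auto
  have neg: "x \<in> Z \<Longrightarrow> (\<lambda>p. - x p) \<in> Z" for x using lin_smult[OF Z, where c = "- 1" and f = x] by simp
  show ?thesis
    by (rule vs_criteria[OF field_real_field]; unfold car)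
       (auto simp: ad sm ze Zc real_field_def algebra_simps intro!: imageI Zc bexI[OF _ neg])
qed

lemma sharp_hyp: "sharp hyperbolic_metric p \<alpha> = (exp (- 2 * snd p) * fst \<alpha>, snd \<alpha>)"
  unfolding sharp_def
proof (rule the_equality)
  show "\<forall>w. hyperbolic_metric p (exp (- 2 * snd p) * fst \<alpha>, snd \<alpha>) w = \<alpha> \<bullet> w"
    by (auto simp: hyperbolic_metric_def inner_prod_def exp_minus field_simps)
  fix v assume a: "\<forall>w. hyperbolic_metric p v w = \<alpha> \<bullet> w"
  from a[rule_format, of "(1,0)"] a[rule_format, of "(0,1)"]
  show "v = (exp (- 2 * snd p) * fst \<alpha>, snd \<alpha>)"
    by (auto simp: hyperbolic_metric_def inner_prod_def exp_minus prod_eq_iff field_simps)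
qed

lemma norm_hyp: "form_norm1 hyperbolic_metric p \<alpha> = norm (exp (- snd p) * fst \<alpha>, snd \<alpha>)"
proof -
  have e: "exp (2 * snd p) * (exp (- 2 * snd p) * fst \<alpha>) * (exp (- 2 * snd p) * fst \<alpha>) = (exp (- snd p) * fst \<alpha>)\<^sup>2"
    by (simp add: power2_eq_square exp_minus exp_double field_simps flip: exp_add)
  show ?thesis
  unfolding form_norm1_def sharp_hyp hyperbolic_metric_def norm_prod_def
  using e by (simp add: power2_eq_square)
qed

lemma vol_hyp: "riemannian_measure hyperbolic_metric = density lborel (\<lambda>p. ennreal (exp (snd p)))"
  unfolding riemannian_measure_def hyperbolic_metric_def by (simp add: real_sqrt_mult[symmetric] exp_double)

context
  fixes \<Phi> and HM :: "plane measure" and HN :: "plane \<Rightarrow> 'v::euclidean_space \<Rightarrow> real"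
  assumes N: "N_function \<Phi>" and sets_HM [measurable_cong, simp]: "sets HM = sets borel"
    and HN_nonneg: "\<And>p a. 0 \<le> HN p a" and HN_scale: "\<And>p c a. HN p (c *\<^sub>R a) = \<bar>c\<bar> * HN p a"
    and HN_add: "\<And>p a b. HN p (a + b) \<le> HN p a + HN p b"
    and HN_meas: "\<And>f. f \<in> borel_measurable borel \<Longrightarrow> (\<lambda>p. HN p (f p)) \<in> borel_measurable borel"
begin

lemma space_HM [simp]: "space HM = UNIV" using sets_eq_imp_space_eq[OF sets_HM] by simp

lemma Phi_nn: "0 \<le> \<Phi> x" using N unfolding N_function_def by auto
lemma Phi_conv: "0 \<le> u \<Longrightarrow> 0 \<le> v \<Longrightarrow> u + v = 1 \<Longrightarrow> \<Phi> (u * x + v * y) \<le> u * \<Phi> x + v * \<Phi> y"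
  using N unfolding N_function_def convex_on_def by auto
lemma Phi0: "\<Phi> 0 = 0" using N unfolding N_function_def by auto
lemma Phi_scale: "0 \<le> t \<Longrightarrow> t \<le> 1 \<Longrightarrow> \<Phi> (t * x) \<le> t * \<Phi> x"
  using Phi_conv[of t "1-t" x 0] Phi0 by simp
lemma Phi_mono: assumes "0 \<le> x" "x \<le> y" shows "\<Phi> x \<le> \<Phi> y"
proof (cases "y = 0")
  case False
  then have "\<Phi> (x/y * y) \<le> x/y * \<Phi> y" using assms by (intro Phi_scale) auto
  also have "\<dots> \<le> 1 * \<Phi> y" using assms Phi_nn[of y] by (intro mult_right_mono) (auto simp: divide_le_eq_1)
  finally show ?thesis using False by simp
qed (use assms in auto)
lemma Phi_meas [measurable]: "\<Phi> \<in> borel_measurable borel"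
  using N unfolding N_function_def
  by (intro borel_measurable_continuous_onI convex_on_continuous) auto

abbreviation "MD \<equiv> modular HM HN \<Phi>"

lemma mod_mono: assumes "\<And>p. HN p (f p) \<le> HN p (h p)" shows "MD f \<le> MD h"
  unfolding modular_def by (intro nn_integral_mono ennreal_leI Phi_mono HN_nonneg assms)

lemma mod_conv: assumes [measurable]: "f \<in> borel_measurable borel" "h \<in> borel_measurable borel"
  and u: "0 \<le> u" "0 \<le> v" "u + v = 1"
  shows "MD (\<lambda>p. u *\<^sub>R f p + v *\<^sub>R h p) \<le> ennreal u * MD f + ennreal v * MD h"
proof -
  note HN_meas[measurable]
  have "MD (\<lambda>p. u *\<^sub>R f p + v *\<^sub>R h p) \<le> (\<integral>\<^sup>+p. ennreal u * ennreal (\<Phi> (HN p (f p))) + ennreal v * ennreal (\<Phi> (HN p (h p))) \<partial>HM)"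
    unfolding modular_def
  proof (rule nn_integral_mono)
    fix p
    have "HN p (u *\<^sub>R f p + v *\<^sub>R h p) \<le> u * HN p (f p) + v * HN p (h p)"
      using HN_add[of p "u *\<^sub>R f p" "v *\<^sub>R h p"] u by (simp add: HN_scale)
    then have "\<Phi> (HN p (u *\<^sub>R f p + v *\<^sub>R h p)) \<le> \<Phi> (u * HN p (f p) + v * HN p (h p))"
      by (intro Phi_mono HN_nonneg)
    also have "\<dots> \<le> u * \<Phi> (HN p (f p)) + v * \<Phi> (HN p (h p))" using u by (rule Phi_conv)
    finally show "ennreal (\<Phi> (HN p (u *\<^sub>R f p + v *\<^sub>R h p))) \<le> ennreal u * ennreal (\<Phi> (HN p (f p))) + ennreal v * ennreal (\<Phi> (HN p (h p)))"
      using u Phi_nn by (simp flip: ennreal_mult ennreal_plus add: ennreal_leI)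
  qed
  also have "\<dots> = ennreal u * MD f + ennreal v * MD h"
    unfolding modular_def by (subst nn_integral_add) (auto simp: nn_integral_cmult)
  finally show ?thesis .
qed

lemma mod_zero: "MD (\<lambda>p. 0) = 0"
proof -
  have "HN p 0 = 0" for p using HN_scale[of p 0 0] by simp
  then show ?thesis unfolding modular_def by (simp add: Phi0)
qed

lemma L1I: "f \<in> borel_measurable borel \<Longrightarrow> 0 < a \<Longrightarrow> MD (\<lambda>p. a *\<^sub>R f p) < \<infinity> \<Longrightarrow> f \<in> orlicz_space HM HN \<Phi>"
  unfolding orlicz_space_def by (auto simp: measurable_def)
lemma L1E: assumes "f \<in> orlicz_space HM HN \<Phi>" obtains a where "f \<in> borel_measurable borel" "0 < a" "MD (\<lambda>p. a *\<^sub>R f p) < \<infinity>"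
proof -
  have "f \<in> borel_measurable HM" using assms unfolding orlicz_space_def by auto
  then have "f \<in> borel_measurable borel" by simp
  then show ?thesis using that assms unfolding orlicz_space_def by auto
qed

lemma L1_scale: assumes "f \<in> orlicz_space HM HN \<Phi>" shows "(\<lambda>p. c *\<^sub>R f p) \<in> orlicz_space HM HN \<Phi>"
proof -
  from L1E[OF assms] obtain a where f: "f \<in> borel_measurable borel" and a: "0 < a" "MD (\<lambda>p. a *\<^sub>R f p) < \<infinity>" .
  let ?b = "a / (1 + \<bar>c\<bar>)"
  have "MD (\<lambda>p. ?b *\<^sub>R (c *\<^sub>R f p)) \<le> MD (\<lambda>p. a *\<^sub>R f p)"
  proof (rule mod_mono)
    fix p
    have "\<bar>?b * c\<bar> \<le> \<bar>a\<bar>" using a by (auto simp: abs_mult field_simps)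
    then show "HN p (?b *\<^sub>R (c *\<^sub>R f p)) \<le> HN p (a *\<^sub>R f p)"
      using HN_nonneg[of p "f p"] unfolding scaleR_scaleR HN_scale by (rule mult_right_mono)
  qed
  with a(2) have "MD (\<lambda>p. ?b *\<^sub>R (c *\<^sub>R f p)) < \<infinity>" by (rule order.strict_trans1[rotated])
  moreover have "0 < ?b" using a by (simp add: add_pos_nonneg)
  ultimately show ?thesis using f by (intro L1I[of _ ?b]) auto
qed

lemma L1_add: assumes "f \<in> orlicz_space HM HN \<Phi>" "h \<in> orlicz_space HM HN \<Phi>"
  shows "(\<lambda>p. f p + h p) \<in> orlicz_space HM HN \<Phi>"
proof -
  from L1E[OF assms(1)] obtain a where f [measurable]: "f \<in> borel_measurable borel" and a: "0 < a" "MD (\<lambda>p. a *\<^sub>R f p) < \<infinity>" .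
  from L1E[OF assms(2)] obtain b where h [measurable]: "h \<in> borel_measurable borel" and b: "0 < b" "MD (\<lambda>p. b *\<^sub>R h p) < \<infinity>" .
  let ?u = "b / (a + b)" and ?v = "a / (a + b)"
  have uv: "0 \<le> ?u" "0 \<le> ?v" "?u + ?v = 1" using a b by (auto simp flip: add_divide_distrib)
  have "MD (\<lambda>p. ?u *\<^sub>R (a *\<^sub>R f p) + ?v *\<^sub>R (b *\<^sub>R h p)) \<le> ennreal ?u * MD (\<lambda>p. a *\<^sub>R f p) + ennreal ?v * MD (\<lambda>p. b *\<^sub>R h p)"
    using uv by (intro mod_conv) auto
  also have "\<dots> < \<infinity>" using a b by (simp add: ennreal_mult_less_top)
  finally have "MD (\<lambda>p. (a*b/(a+b)) *\<^sub>R (f p + h p)) < \<infinity>" by (simp add: scaleR_add_right mult.commute)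
  then show ?thesis using a b by (intro L1I[of _ "a*b/(a+b)"]) auto
qed

lemma lin_orlicz: "lin_closed (orlicz_space HM HN \<Phi>)"
  unfolding lin_closed_def using L1_scale L1_add by (auto intro!: L1I[of _ 1] simp: mod_zero)

abbreviation "GN \<equiv> gauge_norm HM HN \<Phi>"

lemma GN_ex: assumes "f \<in> orlicz_space HM HN \<Phi>" shows "\<exists>K>0. MD (\<lambda>p. f p /\<^sub>R K) \<le> 1"
proof -
  from L1E[OF assms(1)] obtain a where f [measurable]: "f \<in> borel_measurable borel" and a: "0 < a" "MD (\<lambda>p. a *\<^sub>R f p) < \<infinity>" .
  obtain m where m: "MD (\<lambda>p. a *\<^sub>R f p) = ennreal m" "0 \<le> m" using a(2) by (cases "MD (\<lambda>p. a *\<^sub>R f p)") auto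
  let ?t = "1 / (1 + m)"
  have "MD (\<lambda>p. ?t *\<^sub>R (a *\<^sub>R f p) + (1 - ?t) *\<^sub>R 0) \<le> ennreal ?t * MD (\<lambda>p. a *\<^sub>R f p) + ennreal (1 - ?t) * MD (\<lambda>p. 0)"
    using m by (intro mod_conv) auto
  also have "\<dots> \<le> 1" using m by (simp add: mod_zero field_simps flip: ennreal_mult)
  finally have "MD (\<lambda>p. f p /\<^sub>R ((1+m)/a)) \<le> 1" using m a by (simp add: field_simps)
  moreover have "(1+m)/a > 0" using m a by simp
  ultimately show ?thesis by blast
qed

lemma GN_lessD: assumes "f \<in> orlicz_space HM HN \<Phi>" "GN f < e" obtains K where "0 < K" "K < e" "MD (\<lambda>p. f p /\<^sub>R K) \<le> 1"
  using cInf_lessD[of "{K. 0 < K \<and> MD (\<lambda>p. f p /\<^sub>R K) \<le> 1}" e] GN_ex[OF assms(1)] assms(2) that unfolding gauge_norm_def by blast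
lemma GN_le: assumes "0 < K" "MD (\<lambda>p. f p /\<^sub>R K) \<le> 1" shows "GN f \<le> K"
  unfolding gauge_norm_def using assms by (intro cInf_lower bdd_belowI[of _ 0]) auto

lemma GN_add: assumes f: "f \<in> orlicz_space HM HN \<Phi>" "GN f < d" and h: "h \<in> orlicz_space HM HN \<Phi>" "GN h < e"
  shows "GN (\<lambda>p. f p + h p) < d + e"
proof -
  obtain K where K: "0 < K" "K < d" "MD (\<lambda>p. f p /\<^sub>R K) \<le> 1" using GN_lessD[OF f] .
  obtain L where L: "0 < L" "L < e" "MD (\<lambda>p. h p /\<^sub>R L) \<le> 1" using GN_lessD[OF h] .
  have [measurable]: "f \<in> borel_measurable borel" "h \<in> borel_measurable borel" using L1E f h by blast+
  let ?u = "K / (K + L)" and ?v = "L / (K + L)"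
  have uv: "0 \<le> ?u" "0 \<le> ?v" "?u + ?v = 1" using K L by (auto simp flip: add_divide_distrib)
  have "MD (\<lambda>p. ?u *\<^sub>R (f p /\<^sub>R K) + ?v *\<^sub>R (h p /\<^sub>R L)) \<le> ennreal ?u * MD (\<lambda>p. f p /\<^sub>R K) + ennreal ?v * MD (\<lambda>p. h p /\<^sub>R L)"
    using uv by (intro mod_conv) auto
  also have "\<dots> \<le> ennreal ?u * 1 + ennreal ?v * 1" using K L by (intro add_mono mult_left_mono) auto
  also have "\<dots> = 1" using uv by (simp flip: ennreal_plus)
  also have "(\<lambda>p. ?u *\<^sub>R (f p /\<^sub>R K) + ?v *\<^sub>R (h p /\<^sub>R L)) = (\<lambda>p. (f p + h p) /\<^sub>R (K + L))"
    using K L by (simp add: scaleR_add_right field_simps)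
  finally have "GN (\<lambda>p. f p + h p) \<le> K + L" using K L by (intro GN_le) auto
  then show ?thesis using K L by simp
qed

lemma GN_scale: assumes f: "f \<in> orlicz_space HM HN \<Phi>" "GN f < d" and c: "c \<noteq> 0" shows "GN (\<lambda>p. c *\<^sub>R f p) < \<bar>c\<bar> * d"
proof -
  obtain K where K: "0 < K" "K < d" "MD (\<lambda>p. f p /\<^sub>R K) \<le> 1" using GN_lessD[OF f] .
  have "MD (\<lambda>p. (c *\<^sub>R f p) /\<^sub>R (\<bar>c\<bar> * K)) \<le> MD (\<lambda>p. f p /\<^sub>R K)"
    using K c by (intro mod_mono) (simp add: HN_scale abs_mult field_simps)
  then have "GN (\<lambda>p. c *\<^sub>R f p) \<le> \<bar>c\<bar> * K" using K c by (intro GN_le) auto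
  also have "\<dots> < \<bar>c\<bar> * d" using K c by simp
  finally show ?thesis .
qed

lemma lin_closure:
  assumes B: "lin_closed B" "B \<subseteq> orlicz_space HM HN \<Phi>"
  shows "lin_closed {\<omega> \<in> orlicz_space HM HN \<Phi>. \<forall>\<epsilon>>0. \<exists>\<eta>\<in>B. GN (\<lambda>p. \<omega> p - \<eta> p) < \<epsilon>}" (is "lin_closed ?C")
proof -
  have L1d: "f \<in> orlicz_space HM HN \<Phi> \<Longrightarrow> h \<in> orlicz_space HM HN \<Phi> \<Longrightarrow> (\<lambda>p. f p - h p) \<in> orlicz_space HM HN \<Phi>" for f h
    using L1_add[of f "\<lambda>p. (-1) *\<^sub>R h p"] L1_scale[of h "-1"] by simp
  have z: "GN (\<lambda>p. 0) < e" if "e > 0" for e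
    using GN_le[of "e/2" "\<lambda>p. 0"] that by (simp add: mod_zero)
  have z0: "(\<lambda>_. 0) \<in> ?C" using lin_orlicz B z unfolding lin_closed_def by (auto intro!: bexI[of _ "\<lambda>_. 0"])
  have s: "(\<lambda>p. c *\<^sub>R f p) \<in> ?C" if f: "f \<in> ?C" for f and c :: real
  proof (cases "c = 0")
    case True then show ?thesis using z0 by simp
  next
    case False
    have "\<exists>\<eta>\<in>B. GN (\<lambda>p. c *\<^sub>R f p - \<eta> p) < e" if e: "e > 0" for e
    proof -
      obtain b where b: "b \<in> B" "GN (\<lambda>p. f p - b p) < e / \<bar>c\<bar>" using f divide_pos_pos[OF e, of "\<bar>c\<bar>"] False by (auto simp del: zero_less_divide_iff)
      have "(\<lambda>p. f p - b p) \<in> orlicz_space HM HN \<Phi>" using f b B L1d by auto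
      from GN_scale[OF this b(2) False] have "GN (\<lambda>p. c *\<^sub>R f p - c *\<^sub>R b p) < e"
        using False by (simp add: scaleR_diff_right)
      moreover have "(\<lambda>p. c *\<^sub>R b p) \<in> B" using B b unfolding lin_closed_def by auto
      ultimately show ?thesis by (rule bexI)
    qed
    then show ?thesis using f L1_scale by auto
  qed
  have a: "(\<lambda>p. f p + h p) \<in> ?C" if f: "f \<in> ?C" and h: "h \<in> ?C" for f h
  proof -
    have "\<exists>\<eta>\<in>B. GN (\<lambda>p. f p + h p - \<eta> p) < e" if e: "e > 0" for e
    proof -
      have e2: "e/2 > 0" using e by simp
      obtain b where b: "b \<in> B" "GN (\<lambda>p. f p - b p) < e/2" using f e2 by blast
      obtain d where d: "d \<in> B" "GN (\<lambda>p. h p - d p) < e/2" using h e2 by blast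
      have "(\<lambda>p. f p - b p) \<in> orlicz_space HM HN \<Phi>" "(\<lambda>p. h p - d p) \<in> orlicz_space HM HN \<Phi>" using f h d b B L1d by auto
      from GN_add[OF this(1) b(2) this(2) d(2)] have "GN (\<lambda>p. f p + h p - (b p + d p)) < e"
        by (simp add: algebra_simps)
      moreover have "(\<lambda>p. b p + d p) \<in> B" using B b d unfolding lin_closed_def by auto
      ultimately show ?thesis by (rule bexI)
    qed
    then show ?thesis using f h L1_add by auto
  qed
  show ?thesis unfolding lin_closed_def using z0 s a by blast
qed

end



lemma sets_hyp: "sets (riemannian_measure hyperbolic_metric) = sets borel" by (simp add: vol_hyp)

lemma norm_hyp_nonneg: "0 \<le> form_norm1 hyperbolic_metric p a" unfolding norm_hyp by simp
lemma norm_hyp_scale: "form_norm1 hyperbolic_metric p (c *\<^sub>R a) = \<bar>c\<bar> * form_norm1 hyperbolic_metric p a"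
proof -
  have "(exp (- snd p) * fst (c *\<^sub>R a), snd (c *\<^sub>R a)) = c *\<^sub>R (exp (- snd p) * fst a, snd a)" by simp
  then show ?thesis unfolding norm_hyp by (metis norm_scaleR)
qed
lemma norm_hyp_add: "form_norm1 hyperbolic_metric p (a + b) \<le> form_norm1 hyperbolic_metric p a + form_norm1 hyperbolic_metric p b"
proof -
  have "(exp (- snd p) * fst (a+b), snd (a+b)) = (exp (- snd p) * fst a, snd a) + (exp (- snd p) * fst b, snd b)"
    by (simp add: algebra_simps)
  then show ?thesis unfolding norm_hyp by (metis norm_triangle_ineq)
qed
lemma norm_hyp_meas: assumes [measurable]: "f \<in> borel_measurable borel" shows "(\<lambda>p. form_norm1 hyperbolic_metric p (f p)) \<in> borel_measurable (borel :: plane measure)"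
proof -
  have [measurable]: "snd \<in> borel_measurable (borel :: plane measure)" "fst \<in> borel_measurable (borel :: plane measure)"
    by (auto intro!: borel_measurable_continuous_onI continuous_intros)
  show ?thesis unfolding norm_hyp norm_prod_def by simp
qed


lemmas lin_L1 = lin_orlicz[OF _ sets_hyp norm_hyp_nonneg norm_hyp_scale norm_hyp_add norm_hyp_meas, folded L1_def]
lemmas lin_closure_L1 = lin_closure[OF _ sets_hyp norm_hyp_nonneg norm_hyp_scale norm_hyp_add norm_hyp_meas, folded L1_def]
lemma lin_L0: "N_function \<Phi> \<Longrightarrow> lin_closed (L0 hyperbolic_metric \<Phi>)"
  unfolding L0_def by (rule lin_orlicz) (auto simp: form_norm0_def abs_mult sets_hyp)

lemma int_bump:
  fixes f c :: "plane \<Rightarrow> real"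
  assumes f: "locally_integrable f" and c: "continuous_on UNIV c" and K: "compact K" and z: "\<And>p. p \<notin> K \<Longrightarrow> c p = 0"
    and U: "open U"
  shows "set_integrable lborel U (\<lambda>p. f p * c p)"
proof -
  have cm [measurable]: "c \<in> borel_measurable borel" using c by (rule borel_measurable_continuous_onI)
  have "bounded (c ` K)" using c K by (meson compact_continuous_image compact_imp_bounded continuous_on_subset subset_UNIV)
  then obtain B where B: "\<And>p. p \<in> K \<Longrightarrow> \<bar>c p\<bar> \<le> B" unfolding bounded_iff by auto
  have "integrable lborel (\<lambda>p. indicator K p *\<^sub>R f p)" using f K unfolding locally_integrable_def set_integrable_def by blast
  then have "integrable lborel (\<lambda>p. B * (indicator K p *\<^sub>R f p))" by (rule integrable_mult_right)
  moreover have "(\<lambda>p. indicator K p *\<^sub>R f p) \<in> borel_measurable lborel" 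
    using \<open>integrable lborel (\<lambda>p. indicator K p *\<^sub>R f p)\<close> by (rule borel_measurable_integrable)
  then have "(\<lambda>p. (indicator K p *\<^sub>R f p) * c p) \<in> borel_measurable lborel" using cm by measurable
  ultimately have "integrable lborel (\<lambda>p. (indicator K p *\<^sub>R f p) * c p)"
  proof (rule Bochner_Integration.integrable_bound, intro AE_I2)
    fix p show "norm (indicator K p *\<^sub>R f p * c p) \<le> norm (B * (indicator K p *\<^sub>R f p))"
      using B[of p] by (cases "p \<in> K") (auto simp: abs_mult mult.commute[of B] intro!: mult_left_mono)
  qed
  also have "(\<lambda>p. (indicator K p *\<^sub>R f p) * c p) = (\<lambda>p. f p * c p)" using z by (intro ext) (auto simp: indicator_def intro: z)
  finally have "set_integrable lborel UNIV (\<lambda>p. f p * c p)" by (simp add: set_integrable_def)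
  then show ?thesis by (rule set_integrable_subset) (use U in auto)
qed

lemma test_D:
  fixes u :: "plane \<Rightarrow> 'v::real_normed_vector"
  assumes "test_form U u"
  obtains K where "compact K" "continuous_on UNIV u" "\<And>p. p \<notin> K \<Longrightarrow> u p = 0" "\<And>p. u differentiable at p"
    "\<And>v. continuous_on UNIV (\<lambda>p. frechet_derivative u (at p) v)" "\<And>p v. p \<notin> K \<Longrightarrow> frechet_derivative u (at p) v = 0"
proof -
  let ?K = "closure {p. u p \<noteq> 0}"
  have ck: "Ck 0 u" "Ck (Suc 0) u" and K: "compact ?K" using assms unfolding test_form_def smooth_def by blast+
  have d: "u differentiable at p" for p using ck(2) unfolding Ck.simps differentiable_on_def by blast
  have fd: "frechet_derivative u (at p) v = 0" if p: "p \<notin> ?K" for p v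
  proof -
    have "open (- ?K)" by auto
    moreover have "\<And>q. q \<in> - ?K \<Longrightarrow> 0 = u q" using closure_subset[of "{p. u p \<noteq> 0}"] by auto
    ultimately have "(u has_derivative (\<lambda>_. 0)) (at p)"
      by (rule has_derivative_transform_within_open[OF has_derivative_const[of 0] _ Compl_iff[THEN iffD2, OF p]])
    then have "(\<lambda>_. 0) = frechet_derivative u (at p)" by (rule frechet_derivative_at)
    then show ?thesis by metis
  qed
  show ?thesis
  proof (rule that[OF K _ _ d _ fd])
    show "continuous_on UNIV u" using ck(1) by simp
    show "u p = 0" if "p \<notin> ?K" for p using that closure_subset[of "{p. u p \<noteq> 0}"] by blast
    show "continuous_on UNIV (\<lambda>p. frechet_derivative u (at p) v)" for v using ck(2) unfolding Ck.simps by blast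
  qed
qed

lemma comp_li: assumes f: "locally_integrable (f :: plane \<Rightarrow> plane)"
  shows "locally_integrable (\<lambda>p. fst (f p))" "locally_integrable (\<lambda>p. snd (f p))"
proof -
  { fix K assume "compact (K :: plane set)"
    then have i: "integrable lborel (\<lambda>p. indicator K p *\<^sub>R f p)"
      using f unfolding locally_integrable_def set_integrable_def by blast
    from integrable_bounded_linear[OF bounded_linear_fst i] integrable_bounded_linear[OF bounded_linear_snd i]
    have "set_integrable lborel K (\<lambda>p. fst (f p))" "set_integrable lborel K (\<lambda>p. snd (f p))"
      unfolding set_integrable_def by (auto simp: fst_scaleR snd_scaleR)
  }
  then show "locally_integrable (\<lambda>p. fst (f p))" "locally_integrable (\<lambda>p. snd (f p))"
    unfolding locally_integrable_def by auto
qed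

lemma int_d0: assumes U: "open U" and u: "test_form U u" and f: "locally_integrable f"
  shows "set_integrable lborel U (\<lambda>p. wedge11 (f p) (d0 u p))"
proof -
  obtain K where K: "compact K" "continuous_on UNIV u" "\<And>p. p \<notin> K \<Longrightarrow> u p = 0" "\<And>p. u differentiable at p"
    "\<And>v. continuous_on UNIV (\<lambda>p. frechet_derivative u (at p) v)" "\<And>p v. p \<notin> K \<Longrightarrow> frechet_derivative u (at p) v = 0"
    by (rule test_D[OF u]; rule that; assumption)
  show ?thesis unfolding wedge11_def d0_def fst_conv snd_conv
    by (intro set_integral_diff int_bump[OF _ _ K(1)] comp_li f K U)
qed

lemma int_w: assumes U: "open U" and u: "test_form U u" and f: "locally_integrable f"
  shows "set_integrable lborel U (\<lambda>p. wedge11 (f p) (u p))"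
proof -
  obtain K where K: "compact K" "continuous_on UNIV u" "\<And>p. p \<notin> K \<Longrightarrow> u p = 0" "\<And>p. u differentiable at p"
    "\<And>v. continuous_on UNIV (\<lambda>p. frechet_derivative u (at p) v)" "\<And>p v. p \<notin> K \<Longrightarrow> frechet_derivative u (at p) v = 0"
    by (rule test_D[OF u]; rule that; assumption)
  show ?thesis unfolding wedge11_def
    by (intro set_integral_diff int_bump[OF _ _ K(1)] comp_li f K U continuous_intros) (auto simp: K(3))
qed

lemma int_d1: assumes U: "open U" and u: "test_form U u" and f: "locally_integrable f"
  shows "set_integrable lborel U (\<lambda>p. f p * d1 u p)"
proof -
  obtain K where K: "compact K" "continuous_on UNIV u" "\<And>p. p \<notin> K \<Longrightarrow> u p = 0" "\<And>p. u differentiable at p"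
    "\<And>v. continuous_on UNIV (\<lambda>p. frechet_derivative u (at p) v)" "\<And>p v. p \<notin> K \<Longrightarrow> frechet_derivative u (at p) v = 0"
    by (rule test_D[OF u]; rule that; assumption)
  have *: "d1 u p = snd (frechet_derivative u (at p) (1,0)) - fst (frechet_derivative u (at p) (0,1))" for p
  proof -
    have u': "(u has_derivative frechet_derivative u (at p)) (at p)"
      using K(4)[of p] by (simp only: frechet_derivative_works)
    show ?thesis unfolding d1_def
      by (simp only: frechet_derivative_at[OF has_derivative_fst[OF u'], symmetric]
          frechet_derivative_at[OF has_derivative_snd[OF u'], symmetric])
  qed
  have "continuous_on UNIV (\<lambda>p. snd (frechet_derivative u (at p) (1,0)) - fst (frechet_derivative u (at p) (0,1)))"
    by (rule continuous_on_diff[OF continuous_on_snd[OF K(5)] continuous_on_fst[OF K(5)]])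
  then have "continuous_on UNIV (d1 u)" by (subst (asm) *[symmetric])
  moreover have "d1 u p = 0" if "p \<notin> K" for p unfolding * K(6)[OF that] by simp
  ultimately show ?thesis by (rule int_bump[OF f _ K(1) _ U])
qed

lemma li_add: "locally_integrable f \<Longrightarrow> locally_integrable h \<Longrightarrow> locally_integrable (\<lambda>p. f p + h p)"
  unfolding locally_integrable_def by (auto intro!: set_integral_add)
lemma li_scale: "locally_integrable f \<Longrightarrow> locally_integrable (\<lambda>p. c *\<^sub>R f p)"
  unfolding locally_integrable_def by auto
lemma li_0: "locally_integrable (\<lambda>p. 0)" by (simp add: locally_integrable_def set_integrable_def)

lemma w_add: "wedge11 (a + b) c = wedge11 a c + wedge11 b c" by (simp add: wedge11_def algebra_simps)
lemma w_sc: "wedge11 (k *\<^sub>R a) c = k * wedge11 a c" by (simp add: wedge11_def algebra_simps)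
lemma w_0: "wedge11 0 c = 0" by (simp add: wedge11_def)

lemma lin_Z1: assumes N: "N_function \<Phi>" shows "lin_closed (Z1 hyperbolic_metric \<Phi>)"
proof -
  have z: "weak_differential1 (\<lambda>_. 0) (\<lambda>_. 0)" by (simp add: weak_differential1_def li_0 w_0)
  have a: "weak_differential1 (\<lambda>p. f p + h p) (\<lambda>_. 0)" if "weak_differential1 f (\<lambda>_. 0)" "weak_differential1 h (\<lambda>_. 0)" for f h
    using that unfolding weak_differential1_def
    by (auto simp: li_add w_add int_d0)
  have s: "weak_differential1 (\<lambda>p. c *\<^sub>R f p) (\<lambda>_. 0)" if "weak_differential1 f (\<lambda>_. 0)" for f and c :: real
    using that li_scale[of f c] unfolding weak_differential1_def by (auto simp: w_sc)
  show ?thesis unfolding lin_closed_def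
  proof (intro conjI ballI allI)
    show "(\<lambda>_. 0) \<in> Z1 hyperbolic_metric \<Phi>"
      using z lin_L1[OF N] unfolding Z1_def lin_closed_def by blast
    show "(\<lambda>p. f p + h p) \<in> Z1 hyperbolic_metric \<Phi>"
      if "f \<in> Z1 hyperbolic_metric \<Phi>" "h \<in> Z1 hyperbolic_metric \<Phi>" for f h
      using a[of f h] lin_add[OF lin_L1[OF N], of f h] that unfolding Z1_def by blast
    show "(\<lambda>p. c *\<^sub>R f p) \<in> Z1 hyperbolic_metric \<Phi>"
      if "f \<in> Z1 hyperbolic_metric \<Phi>" for f and c :: real
      using s[of f c] lin_smult[OF lin_L1[OF N], of f c] that unfolding Z1_def by blast
  qed
qed

lemma lin_B1: assumes N: "N_function \<Phi>1" "N_function \<Phi>2" shows "lin_closed (B1 hyperbolic_metric \<Phi>1 \<Phi>2)"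
proof -
  have z: "weak_differential0 (\<lambda>_. 0) (\<lambda>_. 0)" by (simp add: weak_differential0_def li_0 w_0)
  have a: "weak_differential0 (\<lambda>p. b p + b' p) (\<lambda>p. t p + t' p)" if "weak_differential0 b t" "weak_differential0 b' t'" for b b' t t'
    using that unfolding weak_differential0_def
    by (auto simp: li_add w_add int_d1 int_w distrib_right)
  have s: "weak_differential0 (\<lambda>p. c *\<^sub>R b p) (\<lambda>p. c *\<^sub>R t p)" if "weak_differential0 b t" for b t and c :: real
    using that li_scale[of b c] li_scale[of t c] unfolding weak_differential0_def
    by (auto simp: w_sc mult.assoc)
  show ?thesis unfolding lin_closed_def
  proof (intro conjI ballI allI)
    show "(\<lambda>_. 0) \<in> B1 hyperbolic_metric \<Phi>1 \<Phi>2"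
      using z lin_L0[OF N(1)] lin_L1[OF N(2)] unfolding B1_def lin_closed_def by blast
  next
    fix f h assume "f \<in> B1 hyperbolic_metric \<Phi>1 \<Phi>2" "h \<in> B1 hyperbolic_metric \<Phi>1 \<Phi>2"
    then obtain b b' where *: "f \<in> L1 hyperbolic_metric \<Phi>2" "h \<in> L1 hyperbolic_metric \<Phi>2"
      "b \<in> L0 hyperbolic_metric \<Phi>1" "b' \<in> L0 hyperbolic_metric \<Phi>1" "weak_differential0 b f" "weak_differential0 b' h"
      unfolding B1_def by auto
    show "(\<lambda>p. f p + h p) \<in> B1 hyperbolic_metric \<Phi>1 \<Phi>2"
      unfolding B1_def mem_Collect_eq
      using a[OF *(5,6)] lin_add[OF lin_L1[OF N(2)] *(1,2)] lin_add[OF lin_L0[OF N(1)] *(3,4)]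
      by (intro conjI bexI)
  next
    fix f and c :: real assume "f \<in> B1 hyperbolic_metric \<Phi>1 \<Phi>2"
    then obtain b where *: "f \<in> L1 hyperbolic_metric \<Phi>2" "b \<in> L0 hyperbolic_metric \<Phi>1" "weak_differential0 b f"
      unfolding B1_def by auto
    show "(\<lambda>p. c *\<^sub>R f p) \<in> B1 hyperbolic_metric \<Phi>1 \<Phi>2"
      unfolding B1_def mem_Collect_eq
      using s[OF *(3), of c] lin_smult[OF lin_L1[OF N(2)] *(1), of c] lin_smult[OF lin_L0[OF N(1)] *(2), of c]
      by (intro conjI bexI)
  qed
qed

theorem vectorspace_reduced_cohomology1: assumes "N_function \<Phi>1" "N_function \<Phi>2"
  shows "vectorspace real_field (reduced_cohomology1 hyperbolic_metric \<Phi>1 \<Phi>2)"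
  unfolding reduced_cohomology1_def B1_closure_def
  by (intro vs_quot lin_Z1 lin_closure_L1 lin_B1 assms) (auto simp: B1_def)


end

theory Submission
  imports Defs
begin

text \<open>
  Why the cohomology is large. On the half plane \<open>z \<ge> 0\<close> the covector \<open>dy\<close> has norm
  \<open>exp (- z)\<close>, while the volume density is \<open>exp z\<close>. So for a form \<open>\<eta>\<close> that lives over a strip
  \<open>{a..b} \<times> {0..}\<close>, here called a collar, and satisfies \<open>\<bar>\<eta>\<bar> \<le> C exp (- z)\<close>, the integral of
  \<open>F \<bar>\<eta>\<bar>\<close> is at most \<open>b - a\<close> times the integral of \<open>F (C exp (- z)) exp z\<close> over \<open>z \<ge> 0\<close>, which
  is \<open>C\<close> times the integral of \<open>F v / v\<^sup>2\<close> over \<open>0 < v \<le> C\<close> (\<open>collar_modular_finite\<close>). The three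
  integral hypotheses therefore say that such forms have finite modular for \<open>\<Phi>2\<close>, \<open>\<Psi>1\<close> and \<open>\<Psi>2\<close>.

  Let \<open>\<sigma>\<close> be a smooth step in \<open>z\<close>, rising from 0 to 1 on \<open>[0, 1]\<close>, and \<open>U\<close> a smooth bump in
  \<open>y\<close>. Then \<open>d (\<sigma> U) = \<sigma> U' dy + \<sigma>' U dz\<close> is closed and of the kind just described, hence lies in
  \<open>Z1\<close>. Its primitive \<open>\<sigma> U\<close> does not decay towards the boundary line \<open>z = \<infinity>\<close>, and this is seen by
  the functional \<open>pairing W\<close>, which maps \<open>\<theta>\<close> to the integral of \<open>\<theta> \<and> d (\<sigma> W)\<close>.

  \<^item> It vanishes on exact forms \<open>d\<beta>\<close> (\<open>pairing_eq_0_of_exact\<close>). Cutting \<open>d (\<sigma> W)\<close> off at height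
    \<open>n\<close> and integrating by parts leaves the integral of \<open>\<beta> \<sigma>'(z - n) W' dy dz\<close>. By Young's
    inequality for \<open>\<Phi>1\<close> and \<open>\<Psi>1\<close>, \<open>\<beta>\<close> is integrable over the collar for \<open>dy dz\<close>, so this tends
    to 0.
  \<^item> It is bounded on the Orlicz space, by Young's inequality for \<open>\<Phi>2\<close> and \<open>\<Psi>2\<close>
    (\<open>pairing_le_modular\<close>), so it also vanishes on the closure (\<open>pairing_eq_0_of_closure\<close>).
  \<^item> On \<open>d (\<sigma> W')\<close> it equals minus the integral of \<open>(W')\<^sup>2\<close>, which is not 0
    (\<open>pairing_deriv_neq_0\<close>), and it is 0 on \<open>d (\<sigma> U)\<close> if the supports of \<open>U\<close> and \<open>W\<close> are
    disjoint.

  For translates \<open>W i\<close> of one bump with disjoint supports, the classes of \<open>d (\<sigma> (W i)')\<close> and the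
  functionals \<open>pairing (W j)\<close> are thus biorthogonal up to nonzero factors, and there are infinitely
  many of them.
\<close>

text \<open>
  Besides \<open>N_function \<Phi>\<close>, this rule has premises about a measure and a pointwise norm that do not
  occur in its conclusion, which makes the measurability prover diverge.
\<close>
declare Phi_meas [measurable del]

section \<open>Smooth functions\<close>

lemma Ck_SucI:
  fixes f :: "'a::real_normed_vector \<Rightarrow> 'b::real_normed_vector"
  assumes "\<And>x. (f has_derivative f' x) (at x)" and "\<And>v. Ck k (\<lambda>x. f' x v)"
  shows "Ck (Suc k) f"
proof -
  have "frechet_derivative f (at x) = f' x" for x
    using frechet_derivative_at[OF assms(1)] by simp
  then show ?thesis
    using assms by (auto simp: differentiable_on_def differentiable_def)
qed

text \<open>
  Elimination with an arbitrary derivative field; the closure properties below then follow by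
  induction on \<open>k\<close> from the rules of differentiation, together with \<open>Ck_SucI\<close>.
\<close>
lemma Ck_SucE:
  fixes f :: "'a::real_normed_vector \<Rightarrow> 'b::real_normed_vector"
  assumes "Ck (Suc k) f"
  obtains f' where "\<And>x. (f has_derivative f' x) (at x)" "\<And>v. Ck k (\<lambda>x. f' x v)"
proof (rule that)
  show "(f has_derivative frechet_derivative f (at x)) (at x)" for x
    using assms by (auto simp: differentiable_on_def simp flip: frechet_derivative_works)
  show "Ck k (\<lambda>x. frechet_derivative f (at x) v)" for v
    using assms by simp
qed

lemma Ck_SucD: "Ck (Suc k) f \<Longrightarrow> Ck k f"
proof (induction k arbitrary: f)
  case 0
  then show ?case by (auto intro: differentiable_imp_continuous_on)
next
  case (Suc k)
  obtain f' where f': "\<And>x. (f has_derivative f' x) (at x)" "\<And>v. Ck (Suc k) (\<lambda>x. f' x v)"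
    using Ck_SucE[OF Suc.prems] by blast
  from f'(1) Suc.IH[OF f'(2)] show ?case by (rule Ck_SucI)
qed

lemma Ck_const: "Ck k (\<lambda>x. c)"
proof (induction k arbitrary: c)
  case (Suc k)
  show ?case by (rule Ck_SucI[OF has_derivative_const Suc.IH])
qed simp

lemma Ck_add:
  "Ck k f \<Longrightarrow> Ck k g \<Longrightarrow> Ck k (\<lambda>x. f x + g x)"
proof (induction k arbitrary: f g)
  case 0
  then show ?case by (auto intro: continuous_intros)
next
  case (Suc k)
  obtain f' where f': "\<And>x. (f has_derivative f' x) (at x)" "\<And>v. Ck k (\<lambda>x. f' x v)"
    using Ck_SucE[OF Suc.prems(1)] by blast
  obtain g' where g': "\<And>x. (g has_derivative g' x) (at x)" "\<And>v. Ck k (\<lambda>x. g' x v)"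
    using Ck_SucE[OF Suc.prems(2)] by blast
  from has_derivative_add[OF f'(1) g'(1)] Suc.IH[OF f'(2) g'(2)] show ?case
    by (rule Ck_SucI)
qed

lemma Ck_scaleR:
  "Ck k f \<Longrightarrow> Ck k g \<Longrightarrow> Ck k (\<lambda>x. f x *\<^sub>R g x)"
proof (induction k arbitrary: f g)
  case 0
  then show ?case by (auto intro: continuous_intros)
next
  case (Suc k)
  obtain f' where f': "\<And>x. (f has_derivative f' x) (at x)" "\<And>v. Ck k (\<lambda>x. f' x v)"
    using Ck_SucE[OF Suc.prems(1)] by blast
  obtain g' where g': "\<And>x. (g has_derivative g' x) (at x)" "\<And>v. Ck k (\<lambda>x. g' x v)"
    using Ck_SucE[OF Suc.prems(2)] by blast
  show ?case
    by (rule Ck_SucI[OF has_derivative_scaleR[OF f'(1) g'(1)]])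
       (intro Ck_add Suc.IH f'(2) g'(2) Ck_SucD[OF Suc.prems(1)] Ck_SucD[OF Suc.prems(2)])
qed

lemma Ck_compose_linear:
  assumes L: "bounded_linear L"
  shows "Ck k f \<Longrightarrow> Ck k (\<lambda>x. f (L x))"
proof (induction k arbitrary: f)
  case 0
  then show ?case
    using continuous_on_compose2[OF _ linear_continuous_on[OF L]] by auto
next
  case (Suc k)
  obtain f' where f': "\<And>x. (f has_derivative f' x) (at x)" "\<And>v. Ck k (\<lambda>x. f' x v)"
    using Ck_SucE[OF Suc.prems] by blast
  show ?case
    by (rule Ck_SucI[OF has_derivative_compose[OF bounded_linear_imp_has_derivative[OF L] f'(1)]])
       (rule Suc.IH[OF f'(2)])
qed

lemma Ck_translate: "Ck k f \<Longrightarrow> Ck k (\<lambda>x. f (x + c))"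
proof (induction k arbitrary: f)
  case 0
  then show ?case
    by (auto intro!: continuous_on_compose2[of UNIV f] continuous_intros)
next
  case (Suc k)
  obtain f' where f': "\<And>x. (f has_derivative f' x) (at x)" "\<And>v. Ck k (\<lambda>x. f' x v)"
    using Ck_SucE[OF Suc.prems] by blast
  have "((\<lambda>x. x + c) has_derivative (\<lambda>h. h)) (at x)" for x
    by (auto intro!: derivative_eq_intros)
  from has_derivative_compose[OF this f'(1)] Suc.IH[OF f'(2)] show ?case
    by (rule Ck_SucI)
qed

lemma Ck_Suc_real:
  fixes f :: "real \<Rightarrow> real"
  assumes "\<And>x. (f has_real_derivative f' x) (at x)" and "Ck k f'"
  shows "Ck (Suc k) f"
proof (rule Ck_SucI)
  show "(f has_derivative (\<lambda>h. f' x * h)) (at x)" for x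
    using assms(1) by (simp add: has_field_derivative_def)
  show "Ck k (\<lambda>x. f' x * v)" for v
    using Ck_scaleR[OF assms(2) Ck_const, of v] by simp
qed

lemma smooth_real_derivative:
  fixes f :: "real \<Rightarrow> real"
  assumes f: "smooth f" and d: "\<And>x. (f has_real_derivative f' x) (at x)"
  shows "smooth f'"
  unfolding smooth_def
proof
  fix k
  have "Ck (Suc k) f" using f by (simp add: smooth_def)
  then obtain g where g: "\<And>x. (f has_derivative g x) (at x)" "\<And>v. Ck k (\<lambda>x. g x v)"
    using Ck_SucE by blast
  have "g x = (\<lambda>h. f' x * h)" for x
    using g(1) d by (metis has_derivative_unique has_field_derivative_def)
  with g(2)[of 1] show "Ck k f'" by simp
qed

lemma smooth_real_antiderivative:
  fixes f :: "real \<Rightarrow> real"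
  assumes "smooth f'" "\<And>x. (f has_real_derivative f' x) (at x)"
  shows "smooth f"
  unfolding smooth_def
proof
  fix k
  have "Ck k f'" using assms(1) by (simp add: smooth_def)
  with assms(2) have "Ck (Suc k) f" by (rule Ck_Suc_real)
  then show "Ck k f" by (rule Ck_SucD)
qed

lemma smooth_real_has_derivative:
  fixes f :: "real \<Rightarrow> real"
  assumes "smooth f"
  shows "(f has_real_derivative deriv f x) (at x)"
proof -
  have "Ck (Suc 0) f" using assms by (simp add: smooth_def)
  then have "f differentiable at x" by (simp add: differentiable_on_def)
  then show ?thesis
    using DERIV_deriv_iff_real_differentiable by blast
qed

lemma smooth_continuous: "smooth f \<Longrightarrow> continuous_on UNIV f"
  unfolding smooth_def by (metis Ck.simps(1))

section \<open>A smooth bump and a smooth step\<close>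

text \<open>
  The functions \<open>p (1 / x) exp (- 1 / x)\<close>, extended by 0. Allowing all polynomials \<open>p\<close> makes the
  family closed under differentiation, so that one induction gives smoothness.
\<close>
definition flat_exp :: "real poly \<Rightarrow> real \<Rightarrow> real" where
  "flat_exp p x = (if x \<le> 0 then 0 else poly p (1 / x) * exp (- (1 / x)))"

lemma poly_exp_tendsto_0: "((\<lambda>t::real. poly p t * exp (- t)) \<longlongrightarrow> 0) at_top"
proof -
  have "((\<lambda>t. \<Sum>i\<le>degree p. coeff p i * (t ^ i / exp t)) \<longlongrightarrow> (\<Sum>i\<le>degree p. coeff p i * 0)) at_top"
    by (intro tendsto_intros tendsto_power_div_exp_0)
  moreover have "(\<lambda>t::real. \<Sum>i\<le>degree p. coeff p i * (t ^ i / exp t)) = (\<lambda>t. poly p t * exp (- t))"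
    by (auto simp: poly_altdef sum_distrib_right exp_minus divide_inverse mult.assoc)
  ultimately show ?thesis by simp
qed

lemma flat_exp_has_derivative:
  "(flat_exp p has_real_derivative flat_exp (monom 1 2 * (p - pderiv p)) x) (at x)"
proof (cases x "0::real" rule: linorder_cases)
  case less
  have "((\<lambda>x. 0) has_real_derivative flat_exp (monom 1 2 * (p - pderiv p)) x) (at x)"
    using less by (simp add: flat_exp_def)
  then show ?thesis
    by (rule DERIV_cong_ev[OF refl _ refl, THEN iffD1, rotated])
       (use less in \<open>auto simp: flat_exp_def eventually_nhds intro!: exI[of _ "{..<0}"]\<close>)
next
  case greater
  have "((\<lambda>x. poly p (1 / x) * exp (- (1 / x))) has_real_derivative
      flat_exp (monom 1 2 * (p - pderiv p)) x) (at x)"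
    using greater
    by (auto intro!: derivative_eq_intros DERIV_chain2[OF poly_DERIV]
        simp: flat_exp_def poly_monom field_simps power2_eq_square)
  then show ?thesis
    by (rule DERIV_cong_ev[OF refl _ refl, THEN iffD1, rotated])
       (use greater in \<open>auto simp: flat_exp_def eventually_nhds intro!: exI[of _ "{0<..}"]\<close>)
next
  case equal
  have "((\<lambda>h. flat_exp p h / h) \<longlongrightarrow> 0) (at_right 0)"
  proof -
    have "((\<lambda>h. poly (pCons 0 p) (inverse h) * exp (- inverse h)) \<longlongrightarrow> 0) (at_right (0::real))"
      by (rule filterlim_compose[OF poly_exp_tendsto_0 filterlim_inverse_at_top_right])
    then show ?thesis
      by (rule Lim_transform_eventually)
         (auto simp: flat_exp_def eventually_at_right_field divide_inverse ac_simps intro!: exI[of _ 1])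
  qed
  moreover have "((\<lambda>h. flat_exp p h / h) \<longlongrightarrow> 0) (at_left 0)"
    by (rule tendsto_eventually)
       (auto simp: flat_exp_def eventually_at_left_field intro!: exI[of _ "-1"])
  ultimately have "((\<lambda>h. flat_exp p h / h) \<longlongrightarrow> 0) (at 0)"
    by (simp add: filterlim_split_at)
  then show ?thesis
    using equal by (simp add: DERIV_def flat_exp_def)
qed

lemma smooth_flat_exp: "smooth (flat_exp p)"
  unfolding smooth_def
proof
  fix k show "Ck k (flat_exp p)"
  proof (induction k arbitrary: p)
    case 0
    show ?case
      using DERIV_isCont[OF flat_exp_has_derivative] by (simp add: continuous_at_imp_continuous_on)
  next
    case (Suc k)
    show ?case by (rule Ck_Suc_real[OF flat_exp_has_derivative Suc.IH])
  qed
qed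

text \<open>
  The bump is \<open>exp (- 1 / x) exp (- 1 / (1 - x))\<close> on the open unit interval.
\<close>
lemma smooth_bump_exists:
  obtains b :: "real \<Rightarrow> real" where "smooth b"
    "\<And>x. 0 < x \<Longrightarrow> x < 1 \<Longrightarrow> 0 < b x" "\<And>x. x \<le> 0 \<or> 1 \<le> x \<Longrightarrow> b x = 0"
proof
  let ?b = "\<lambda>x::real. flat_exp 1 x *\<^sub>R flat_exp 1 (- (x + - 1))"
  have "Ck k (\<lambda>x. flat_exp 1 (- x))" for k
    by (rule Ck_compose_linear[of uminus])
       (use smooth_flat_exp in \<open>auto simp: smooth_def bounded_linear_minus bounded_linear_ident\<close>)
  then have "Ck k (\<lambda>x. flat_exp 1 (- (x + - 1)))" for k
    by (rule Ck_translate)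
  then show "smooth ?b"
    using smooth_flat_exp unfolding smooth_def by (intro allI Ck_scaleR) auto
qed (auto simp: flat_exp_def)

text \<open>
  A primitive of the bump is constant on both sides of the unit interval, and strictly larger on the
  right; an affine rescaling makes the two constants 0 and 1.
\<close>
lemma smooth_step_exists:
  obtains \<sigma> :: "real \<Rightarrow> real" where "smooth \<sigma>"
    "\<And>x. x \<le> 0 \<Longrightarrow> \<sigma> x = 0" "\<And>x. 1 \<le> x \<Longrightarrow> \<sigma> x = 1"
proof -
  obtain b :: "real \<Rightarrow> real" where b: "smooth b"
    "\<And>x. 0 < x \<Longrightarrow> x < 1 \<Longrightarrow> 0 < b x" "\<And>x. x \<le> 0 \<or> 1 \<le> x \<Longrightarrow> b x = 0"
    by (rule smooth_bump_exists) blast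
  have "isCont b x" for x
    using smooth_continuous[OF b(1)] by (simp add: continuous_on_eq_continuous_at)
  with einterval_antiderivative[of "-\<infinity>" "\<infinity>" b]
  obtain F where F: "\<And>x. (F has_real_derivative b x) (at x)"
    by (auto simp: has_real_derivative_iff_has_vector_derivative)
  have pos: "F 0 < F 1"
    by (rule DERIV_pos_imp_increasing_open[of 0 1 F])
       (use F b(2) in \<open>auto intro!: continuous_at_imp_continuous_on DERIV_isCont[OF F]\<close>)
  have c0: "F x = F 0" if "x \<le> 0" for x
  proof (cases "x = 0")
    case False
    have "(F has_real_derivative 0) (at y)" if "y < 0" for y using F[of y] b(3)[of y] that by simp
    then have "F 0 = F x"
      using that False by (intro DERIV_isconst_end[of x 0 F])
        (auto intro!: continuous_at_imp_continuous_on DERIV_isCont[OF F])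
    then show ?thesis ..
  qed simp
  have c1: "F x = F 1" if "1 \<le> x" for x
  proof (cases "x = 1")
    case False
    have "(F has_real_derivative 0) (at y)" if "1 < y" for y using F[of y] b(3)[of y] that by simp
    then show ?thesis
      using that False by (intro DERIV_isconst_end[of 1 x F])
        (auto intro!: continuous_at_imp_continuous_on DERIV_isCont[OF F])
  qed simp
  let ?s = "\<lambda>x. inverse (F 1 - F 0) * (F x - F 0)"
  show ?thesis
  proof (rule that[of ?s])
    have "Ck k (\<lambda>x. inverse (F 1 - F 0) *\<^sub>R b x)" for k
      using b(1) unfolding smooth_def by (intro Ck_scaleR Ck_const) auto
    then have "smooth (\<lambda>x. inverse (F 1 - F 0) * b x)" by (simp add: smooth_def)
    moreover have "(?s has_real_derivative inverse (F 1 - F 0) * b x) (at x)" for x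
      by (auto intro!: derivative_eq_intros F)
    ultimately show "smooth ?s" by (rule smooth_real_antiderivative)
    show "?s x = 0" if "x \<le> 0" for x using c0[OF that] by simp
    show "?s x = 1" if "1 \<le> x" for x using c1[OF that] pos by simp
  qed
qed

section \<open>Complementary functions\<close>

lemma N_function_nonneg: "N_function \<Phi> \<Longrightarrow> 0 \<le> \<Phi> x"
  by (auto simp: N_function_def)

lemma N_function_zero: "N_function \<Phi> \<Longrightarrow> \<Phi> 0 = 0"
  by (auto simp: N_function_def)

text \<open>
  Superlinear growth of \<open>\<Phi>\<close> makes \<open>x \<bar>y\<bar> - \<Phi> x\<close> nonpositive for large \<open>x\<close>. The supremum in
  \<open>complementary\<close> is only meaningful because of this bound.
\<close>
lemma bdd_above_complementary:
  assumes "N_function \<Phi>"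
  shows "bdd_above ((\<lambda>x. x * \<bar>y\<bar> - \<Phi> x) ` {0..})"
proof -
  have "eventually (\<lambda>x. \<bar>y\<bar> \<le> \<Phi> x / x) at_top"
    using assms by (auto simp: N_function_def filterlim_at_top)
  then obtain X where X: "\<And>x. X \<le> x \<Longrightarrow> \<bar>y\<bar> \<le> \<Phi> x / x"
    by (auto simp: eventually_at_top_linorder)
  have "x * \<bar>y\<bar> - \<Phi> x \<le> \<bar>X\<bar> * \<bar>y\<bar>" if "0 \<le> x" for x
  proof (cases "x \<le> \<bar>X\<bar>")
    case True
    then have "x * \<bar>y\<bar> \<le> \<bar>X\<bar> * \<bar>y\<bar>" by (intro mult_right_mono) auto
    then show ?thesis using N_function_nonneg[OF assms, of x] by simp
  next
    case False
    then have "\<bar>y\<bar> \<le> \<Phi> x / x" "0 < x" using X that by auto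
    then have "x * \<bar>y\<bar> \<le> \<Phi> x" by (simp add: pos_le_divide_eq mult.commute)
    moreover have "0 \<le> \<bar>X\<bar> * \<bar>y\<bar>" by simp
    ultimately show ?thesis by linarith
  qed
  then show ?thesis by (auto intro!: bdd_aboveI[of _ "\<bar>X\<bar> * \<bar>y\<bar>"])
qed

lemma Young_inequality:
  assumes "N_function \<Phi>" "0 \<le> x" "0 \<le> y"
  shows "x * y \<le> \<Phi> x + complementary \<Phi> y"
proof -
  have "x * \<bar>y\<bar> - \<Phi> x \<le> complementary \<Phi> y"
    unfolding complementary_def
    using assms by (intro cSUP_upper bdd_above_complementary) auto
  then show ?thesis using assms by simp
qed

lemma complementary_zero:
  assumes "N_function \<Phi>" shows "complementary \<Phi> 0 = 0"
proof (rule antisym)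
  show "complementary \<Phi> 0 \<le> 0"
    unfolding complementary_def using N_function_nonneg[OF assms] by (intro cSUP_least) auto
  show "0 \<le> complementary \<Phi> 0"
    using Young_inequality[OF assms, of 0 0] N_function_zero[OF assms] by simp
qed

lemma complementary_mono:
  assumes "N_function \<Phi>" "0 \<le> x" "x \<le> y"
  shows "complementary \<Phi> x \<le> complementary \<Phi> y"
  unfolding complementary_def
proof (rule cSUP_mono)
  fix t :: real assume "t \<in> {0..}"
  then show "\<exists>s\<in>{0..}. t * \<bar>x\<bar> - \<Phi> t \<le> s * \<bar>y\<bar> - \<Phi> s"
    using assms by (intro bexI[of _ t]) (auto intro!: mult_left_mono)
qed (use bdd_above_complementary[OF assms(1)] in auto)

section \<open>Finite modulars over a half strip\<close>

text \<open>
  What the estimates over the collar need of \<open>\<Phi>2\<close>, \<open>\<Psi>1\<close> and \<open>\<Psi>2\<close> alike; for a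
  complementary function it follows at once from the formula for the supremum.
\<close>
definition modular_gauge :: "(real \<Rightarrow> real) \<Rightarrow> bool" where
  "modular_gauge F \<longleftrightarrow> F 0 = 0 \<and> mono_on {0..} F"

lemma modular_gauge_nonneg: "modular_gauge F \<Longrightarrow> 0 \<le> x \<Longrightarrow> 0 \<le> F x"
  unfolding modular_gauge_def using mono_onD[of "{0..}" F 0 x] by simp

lemma modular_gauge_mono: "modular_gauge F \<Longrightarrow> 0 \<le> x \<Longrightarrow> x \<le> y \<Longrightarrow> F x \<le> F y"
  unfolding modular_gauge_def using mono_onD[of "{0..}" F x y] by simp

lemma modular_gauge_N_function: "N_function \<Phi> \<Longrightarrow> modular_gauge \<Phi>"
  unfolding modular_gauge_def 
  using Phi_mono[OF _ sets_hyp norm_hyp_nonneg norm_hyp_scale norm_hyp_add norm_hyp_meas, of \<Phi>]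
    N_function_zero[of \<Phi>]
  by (auto intro!: mono_onI)

lemma modular_gauge_complementary: "N_function \<Phi> \<Longrightarrow> modular_gauge (complementary \<Phi>)"
  unfolding modular_gauge_def using complementary_zero complementary_mono
  by (auto intro!: mono_onI)

text \<open>
  A function that is monotone on \<open>[0, \<infinity>)\<close> becomes monotone on the line, hence Borel, after
  composition with \<open>max 0\<close>.
\<close>
lemma modular_gauge_measurable:
  assumes F: "modular_gauge F" and [measurable]: "f \<in> borel_measurable M"
    and nn: "\<And>x. 0 \<le> f x"
  shows "(\<lambda>x. F (f x)) \<in> borel_measurable M"
proof -
  have "mono (\<lambda>x. F (max 0 x))"
    by (intro monoI modular_gauge_mono[OF F]) auto
  then have [measurable]: "(\<lambda>x. F (max 0 x)) \<in> borel_measurable borel"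
    by (rule borel_measurable_mono)
  have "(\<lambda>x. F (max 0 (f x))) \<in> borel_measurable M" by measurable
  then show ?thesis using nn by (simp add: max_def)
qed

text \<open>
  Substitute \<open>v = M exp (- z)\<close>: the integral becomes \<open>M\<close> times that of \<open>F v / v\<^sup>2\<close> over
  \<open>0 < v \<le> M\<close>. Only the part near 0 matters, because \<open>F\<close> is bounded on \<open>[1, M]\<close>.
\<close>
lemma exponential_integral_finite:
  assumes F: "modular_gauge F" and M: "0 < M"
    and fin: "(\<integral>\<^sup>+v\<in>{0<..1}. ennreal (F v / v\<^sup>2) \<partial>lborel) < \<infinity>"
  shows "(\<integral>\<^sup>+z\<in>{0..}. ennreal (F (M * exp (- z)) * exp z) \<partial>lborel) < \<infinity>"
proof -
  note nn = modular_gauge_nonneg[OF F]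
  define f where "f v = F \<bar>v\<bar> / v\<^sup>2" for v
  have f_nn: "0 \<le> f v" for v using nn[of "\<bar>v\<bar>"] by (simp add: f_def)
  have [measurable]: "(\<lambda>v::real. F \<bar>v\<bar>) \<in> borel_measurable borel"
    by (rule modular_gauge_measurable[OF F]) auto
  have [measurable]: "f \<in> borel_measurable borel" unfolding f_def by measurable
  have "integrable lborel (\<lambda>v. indicator {0<..1} v *\<^sub>R f v)"
  proof (rule integrableI_bounded)
    have "(\<integral>\<^sup>+v. ennreal (norm (indicator {0<..1} v *\<^sub>R f v)) \<partial>lborel)
        = (\<integral>\<^sup>+v\<in>{0<..1}. ennreal (F v / v\<^sup>2) \<partial>lborel)"
      by (intro nn_integral_cong) (auto simp: f_def nn split: split_indicator)
    with fin show "(\<integral>\<^sup>+v. ennreal (norm (indicator {0<..1} v *\<^sub>R f v)) \<partial>lborel) < \<infinity>" by simp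
  qed measurable
  moreover have "integrable lborel (\<lambda>v. indicator {1..M} v *\<^sub>R f v)"
  proof (rule Bochner_Integration.integrable_bound)
    show "integrable lborel (\<lambda>v. indicator {1..M} v *\<^sub>R F M)"
      by (intro integrable_scaleR_left integrable_real_indicator) (auto simp: emeasure_lborel_Icc_eq)
    have "f v \<le> F M" if "1 \<le> v" "v \<le> M" for v
    proof -
      have "F v / v\<^sup>2 \<le> F v" using that nn[of v] by (simp add: divide_le_eq mult_le_cancel_left1)
      also have "F v \<le> F M" using that by (intro modular_gauge_mono[OF F]) auto
      finally show ?thesis using that by (simp add: f_def)
    qed
    then show "AE v in lborel. norm (indicator {1..M} v *\<^sub>R f v) \<le> norm (indicator {1..M} v *\<^sub>R F M)"
      using f_nn nn[of M] M by (intro AE_I2) (auto split: split_indicator)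
  qed measurable
  ultimately have "set_integrable lborel ({0<..1} \<union> {1..M}) f"
    by (intro set_integrable_Un) (auto simp: set_integrable_def)
  then have "set_integrable lborel {0<..M} f"
    by (rule set_integrable_subset) auto
  then have "f absolutely_integrable_on {0<..M}"
    unfolding set_integrable_def by (subst integrable_completion) auto
  moreover have "(\<lambda>z. M * exp (- z)) ` {0..} = {0<..M}"
  proof (intro equalityI subsetI)
    fix v assume v: "v \<in> {0<..M}"
    then have "v = M * exp (- ln (M / v))" "0 \<le> ln (M / v)"
      using M by (auto simp: exp_minus)
    then show "v \<in> (\<lambda>z. M * exp (- z)) ` {0..}" by (metis atLeast_iff imageI)
  qed (use M in \<open>auto simp: mult_le_cancel_left1\<close>)
  ultimately have "(\<lambda>z. \<bar>- (M * exp (- z))\<bar> *\<^sub>R f (M * exp (- z))) absolutely_integrable_on {0..}"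
    using M by (subst absolutely_integrable_change_of_variables_real[symmetric])
      (auto intro!: derivative_eq_intros simp: inj_on_def)
  then have "integrable lborel (\<lambda>z. indicator {0..} z *\<^sub>R (\<bar>- (M * exp (- z))\<bar> *\<^sub>R f (M * exp (- z))))"
    unfolding set_integrable_def by (subst (asm) integrable_completion) auto
  then have "integrable lborel (\<lambda>z. M * (indicator {0..} z *\<^sub>R (\<bar>- (M * exp (- z))\<bar> *\<^sub>R f (M * exp (- z)))))"
    by (rule integrable_mult_right)
  then have "(\<integral>\<^sup>+z. ennreal (norm (M * (indicator {0..} z *\<^sub>R (\<bar>- (M * exp (- z))\<bar> *\<^sub>R f (M * exp (- z)))))) \<partial>lborel) < \<infinity>"
    by (simp only: integrable_iff_bounded)
  also have "(\<integral>\<^sup>+z. ennreal (norm (M * (indicator {0..} z *\<^sub>R (\<bar>- (M * exp (- z))\<bar> *\<^sub>R f (M * exp (- z)))))) \<partial>lborel)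
     = (\<integral>\<^sup>+z\<in>{0..}. ennreal (F (M * exp (- z)) * exp z) \<partial>lborel)"
    using M nn by (intro nn_integral_cong)
      (auto simp: f_def abs_mult exp_minus power2_eq_square field_simps split: split_indicator)
  finally show ?thesis .
qed

abbreviation hyp_measure :: "plane measure" where
  "hyp_measure \<equiv> riemannian_measure hyperbolic_metric"

abbreviation hyp_norm :: "plane \<Rightarrow> plane \<Rightarrow> real" where
  "hyp_norm \<equiv> form_norm1 hyperbolic_metric"

lemma nn_integral_hyp_measure:
  assumes "f \<in> borel_measurable borel"
  shows "(\<integral>\<^sup>+p. f p \<partial>hyp_measure) = (\<integral>\<^sup>+p. ennreal (exp (snd p)) * f p \<partial>lborel)"
  unfolding vol_hyp using assms
  by (intro nn_integral_density) (auto intro!: borel_measurable_continuous_onI continuous_intros)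

text \<open>
  The volume density \<open>exp z\<close> is exactly the factor in \<open>exponential_integral_finite\<close>; the
  \<open>y\<close>-direction contributes the length of \<open>{a..b}\<close>.
\<close>
lemma collar_modular_finite:
  fixes G :: "plane \<Rightarrow> real"
  assumes F: "modular_gauge F" and M: "0 < M"
    and fin: "(\<integral>\<^sup>+v\<in>{0<..1}. ennreal (F v / v\<^sup>2) \<partial>lborel) < \<infinity>"
    and G: "\<And>p. 0 \<le> G p" "\<And>p. G p \<le> M * exp (- snd p)"
      "\<And>p. p \<notin> {a..b} \<times> {0..} \<Longrightarrow> G p = 0"
  shows "(\<integral>\<^sup>+p. ennreal (F (G p)) \<partial>hyp_measure) < \<infinity>"
proof -
  have [measurable]: "(\<lambda>z::real. F (M * exp (- z))) \<in> borel_measurable borel"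
    by (rule modular_gauge_measurable[OF F]) (use M in auto)
  define k where "k p = indicator {a..b} (fst p) * (indicator {0..} (snd p) * ennreal (F (M * exp (- snd p))))" for p :: plane
  have k_meas: "k \<in> borel_measurable (borel \<Otimes>\<^sub>M borel)" unfolding k_def by measurable
  then have k_meas': "k \<in> borel_measurable borel" by (simp add: borel_prod)
  have "(\<integral>\<^sup>+p. ennreal (F (G p)) \<partial>hyp_measure) \<le> (\<integral>\<^sup>+p. k p \<partial>hyp_measure)"
  proof (rule nn_integral_mono)
    fix p
    show "ennreal (F (G p)) \<le> k p"
    proof (cases "p \<in> {a..b} \<times> {0..}")
      case True
      then show ?thesis
        using modular_gauge_mono[OF F G(1) G(2)] by (cases p) (auto simp: k_def intro: ennreal_leI)
    next
      case False
      then show ?thesis using G(3)[of p] F by (simp add: modular_gauge_def)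
    qed
  qed
  also have "\<dots> = (\<integral>\<^sup>+p. ennreal (exp (snd p)) * k p \<partial>(lborel \<Otimes>\<^sub>M lborel))"
    by (simp add: nn_integral_hyp_measure[OF k_meas'] lborel_prod)
  also have "\<dots> = (\<integral>\<^sup>+y. \<integral>\<^sup>+z. ennreal (exp (snd (y, z))) * k (y, z) \<partial>lborel \<partial>lborel)"
    using k_meas by (intro lborel.nn_integral_fst[symmetric]) measurable
  also have "\<dots> = (\<integral>\<^sup>+y. indicator {a..b} y * (\<integral>\<^sup>+z\<in>{0..}. ennreal (F (M * exp (- z)) * exp z) \<partial>lborel) \<partial>lborel)"
  proof (rule nn_integral_cong)
    fix y :: real
    have "(\<integral>\<^sup>+z. ennreal (exp (snd (y, z))) * k (y, z) \<partial>lborel)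
      = (\<integral>\<^sup>+z. indicator {a..b} y * (ennreal (F (M * exp (- z)) * exp z) * indicator {0..} z) \<partial>lborel)"
      using M by (intro nn_integral_cong)
        (auto simp: k_def ennreal_mult modular_gauge_nonneg[OF F] ac_simps split: split_indicator)
    also have "\<dots> = indicator {a..b} y * (\<integral>\<^sup>+z\<in>{0..}. ennreal (F (M * exp (- z)) * exp z) \<partial>lborel)"
      by (rule nn_integral_cmult) measurable
    finally show "(\<integral>\<^sup>+z. ennreal (exp (snd (y, z))) * k (y, z) \<partial>lborel) = \<dots>" .
  qed
  also have "\<dots> = emeasure lborel {a..b} * (\<integral>\<^sup>+z\<in>{0..}. ennreal (F (M * exp (- z)) * exp z) \<partial>lborel)"
    by (simp add: nn_integral_multc)
  also have "\<dots> < \<infinity>"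
    using exponential_integral_finite[OF F M fin] by (simp add: ennreal_mult_less_top emeasure_lborel_Icc_eq)
  finally show ?thesis .
qed

text \<open>
  Cauchy-Schwarz in the orthonormal coframe \<open>exp z dy, dz\<close>: the factor \<open>exp z\<close> converts the area
  form \<open>dy \<and> dz\<close> into the volume form.
\<close>
lemma abs_wedge11_le: "\<bar>wedge11 \<alpha> \<beta>\<bar> \<le> exp (snd p) * (hyp_norm p \<alpha> * hyp_norm p \<beta>)"
proof -
  let ?e = "exp (- snd p)"
  let ?x = "(?e * fst \<alpha>, snd \<alpha>)" and ?y = "(snd \<beta>, - (?e * fst \<beta>))"
  have "wedge11 \<alpha> \<beta> = exp (snd p) * (?x \<bullet> ?y)"
    by (simp add: wedge11_def exp_minus field_simps)
  moreover have "\<bar>?x \<bullet> ?y\<bar> \<le> norm ?x * norm ?y" by (rule Cauchy_Schwarz_ineq2)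
  moreover have "norm ?y = hyp_norm p \<beta>" "norm ?x = hyp_norm p \<alpha>"
    by (auto simp: norm_hyp norm_prod_def add.commute)
  ultimately show ?thesis by (simp add: abs_mult)
qed

section \<open>Smooth functions with support in an interval\<close>

lemma smooth_deriv: "smooth (f :: real \<Rightarrow> real) \<Longrightarrow> smooth (deriv f)"
  using smooth_real_derivative smooth_real_has_derivative by blast

definition bump :: "real \<Rightarrow> real \<Rightarrow> (real \<Rightarrow> real) \<Rightarrow> bool" where
  "bump a b U \<longleftrightarrow> smooth U \<and> (\<forall>y. y \<notin> {a..b} \<longrightarrow> U y = 0)"

lemma deriv_eq_0_of_locally_const:
  fixes f :: "real \<Rightarrow> real"
  assumes "open S" "x \<in> S" "\<And>y. y \<in> S \<Longrightarrow> f y = c"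
  shows "deriv f x = 0"
proof -
  have "((\<lambda>_. c) has_real_derivative 0) (at x)" by simp
  then have "(f has_real_derivative 0) (at x)"
    by (rule has_field_derivative_transform_within_open) (use assms in auto)
  then show ?thesis by (rule DERIV_imp_deriv)
qed

lemma bump_deriv: "bump a b U \<Longrightarrow> bump a b (deriv U)"
  unfolding bump_def using deriv_eq_0_of_locally_const[of "- {a..b}" _ U 0] smooth_deriv
  by (auto simp: open_Compl)

lemma bump_bounded:
  assumes "bump a b U" obtains C where "0 < C" "\<And>y. \<bar>U y\<bar> \<le> C"
proof -
  have "bounded (U ` {a..b})"
    using assms by (intro compact_imp_bounded compact_continuous_image)
      (auto simp: bump_def intro: continuous_on_subset[OF smooth_continuous])
  then obtain C where C: "0 < C" "\<And>y. y \<in> {a..b} \<Longrightarrow> \<bar>U y\<bar> \<le> C"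
    unfolding bounded_pos by auto
  have "\<bar>U y\<bar> \<le> C" for y
    using C assms by (cases "y \<in> {a..b}") (auto simp: bump_def)
  with C(1) show ?thesis by (rule that)
qed

section \<open>Integration of compactly supported functions\<close>

lemma lborel_integrable_of_compact_support:
  fixes f :: "'a::euclidean_space \<Rightarrow> 'b::{banach, second_countable_topology}"
  assumes "continuous_on UNIV f" "compact K" "\<And>p. p \<notin> K \<Longrightarrow> f p = 0"
  shows "integrable lborel f"
proof -
  have "integrable lborel (\<lambda>p. indicator K p *\<^sub>R f p)"
    using assms by (intro borel_integrable_compact) (auto intro: continuous_on_subset)
  also have "(\<lambda>p. indicator K p *\<^sub>R f p) = f" using assms(3) by (auto simp: indicator_def)
  finally show ?thesis .
qed

lemma integral_deriv_compact_support:
  fixes g :: "real \<Rightarrow> real"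
  assumes d: "\<And>x. (g has_real_derivative g' x) (at x)" and c: "continuous_on UNIV g'"
    and z: "\<And>x. x \<notin> {a..b} \<Longrightarrow> g x = 0"
  shows "(LINT x|lborel. g' x) = 0"
proof -
  have g'z: "g' x = 0" if "x \<notin> {a..b}" for x
    using deriv_eq_0_of_locally_const[of "- {a..b}" x g 0] that z DERIV_imp_deriv[OF d]
    by (auto simp: open_Compl)
  \<comment> \<open>The minimum and maximum cover the case that \<open>{a..b}\<close> is empty.\<close>
  define A B where "A = min a b - 1" and "B = max a b + 1"
  have AB: "A \<le> B" "A \<notin> {a..b}" "B \<notin> {a..b}" "{a..b} \<subseteq> {A..B}" by (auto simp: A_def B_def)
  have "g' x = g' x * indicator {A..B} x" for x
    using g'z[of x] AB(4) by (cases "x \<in> {a..b}") auto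
  then have "(LINT x|lborel. g' x) = (LINT x|lborel. g' x * indicator {A..B} x)"
    by (intro Bochner_Integration.integral_cong refl)
  also have "\<dots> = g B - g A"
    using AB(1) d c by (intro integral_FTC_Icc_real) (auto simp: continuous_on_eq_continuous_at)
  also have "\<dots> = 0" using z AB by simp
  finally show ?thesis .
qed

lemma integral_along_line_compact_support:
  fixes g :: "'a::euclidean_space \<Rightarrow> real"
  assumes d: "\<And>p. (g has_derivative g' p) (at p)" and c: "continuous_on UNIV (\<lambda>p. g' p v)"
    and K: "compact K" "\<And>p. p \<notin> K \<Longrightarrow> g p = 0" and v: "v \<noteq> 0"
  shows "(LINT t|lborel. g' (p + t *\<^sub>R v) v) = 0"
proof -
  obtain R where R: "\<And>q. q \<in> K \<Longrightarrow> norm q \<le> R"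
    using compact_imp_bounded[OF K(1)] by (auto simp: bounded_iff)
  define S where "S = (R + norm p) / norm v"
  have line: "((\<lambda>t. p + t *\<^sub>R v) has_derivative (\<lambda>h. h *\<^sub>R v)) (at t)" for t
    by (auto intro!: derivative_eq_intros)
  have "((\<lambda>t. g (p + t *\<^sub>R v)) has_derivative (\<lambda>h. g' (p + t *\<^sub>R v) (h *\<^sub>R v))) (at t)" for t
    by (rule has_derivative_compose[OF line d])
  moreover have "g' q (h *\<^sub>R v) = g' q v * h" for q h
    using linear_scale[OF has_derivative_linear[OF d]] by simp
  ultimately have "((\<lambda>t. g (p + t *\<^sub>R v)) has_real_derivative g' (p + t *\<^sub>R v) v) (at t)" for t
    by (simp add: has_field_derivative_def)
  then show ?thesis
  proof (rule integral_deriv_compact_support[of _ _ "-S" S])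
    show "continuous_on UNIV (\<lambda>t. g' (p + t *\<^sub>R v) v)"
      by (rule continuous_on_compose2[OF c]) (auto intro!: continuous_intros)
    show "g (p + t *\<^sub>R v) = 0" if "t \<notin> {-S..S}" for t
    proof (rule K(2), rule notI)
      assume "p + t *\<^sub>R v \<in> K"
      then have "norm (p + t *\<^sub>R v) \<le> R" by (rule R)
      then have "norm (t *\<^sub>R v) \<le> R + norm p"
        using norm_triangle_ineq4[of "p + t *\<^sub>R v" p] by simp
      then have "\<bar>t\<bar> \<le> S" using v by (simp add: S_def pos_le_divide_eq)
      then show False using that by auto
    qed
  qed
qed

text \<open>
  Stokes' theorem for the 1-forms \<open>g dz\<close> and \<open>g dy\<close>: integrate first along the lines on which the
  derivative is taken.
\<close>
lemma integral_partial_compact_support: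
  fixes g :: "plane \<Rightarrow> real"
  assumes d: "\<And>p. (g has_derivative g' p) (at p)" and c: "\<And>v. continuous_on UNIV (\<lambda>p. g' p v)"
    and K: "compact K" "\<And>p. p \<notin> K \<Longrightarrow> g p = 0"
  shows "integrable lborel (\<lambda>p. g' p v)"
    and "(LINT p|lborel. g' p (1,0)) = 0" and "(LINT p|lborel. g' p (0,1)) = 0"
proof -
  have g'K: "g' p v = 0" if "p \<notin> K" for p v
  proof -
    have "open (- K)" "p \<in> - K" "\<And>q. q \<in> - K \<Longrightarrow> 0 = g q"
      using K that by (auto simp: compact_imp_closed open_Compl)
    then have "(g has_derivative (\<lambda>_. 0)) (at p)"
      by (rule has_derivative_transform_within_open[OF has_derivative_const[of 0]])
    then show ?thesis using has_derivative_unique[OF d[of p]] by fastforce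
  qed
  have int: "integrable lborel (\<lambda>p. g' p v)" for v
    using c K(1) g'K by (rule lborel_integrable_of_compact_support)
  then have int': "integrable (lborel \<Otimes>\<^sub>M lborel) (\<lambda>(y, z). g' (y, z) v)" for v
    by (simp add: lborel_prod case_prod_beta')
  have eq: "(LINT p|lborel. g' p v) = (LINT p|(lborel \<Otimes>\<^sub>M lborel). (\<lambda>(y, z). g' (y, z) v) p)" for v
    by (simp add: lborel_prod case_prod_beta')
  show "integrable lborel (\<lambda>p. g' p v)" by (rule int)
  have "(LINT y|lborel. g' (y, z) (1,0)) = 0" for z
    using integral_along_line_compact_support[OF d c K, of "(1,0)" "(0,z)"] by (simp add: zero_prod_def)
  then show "(LINT p|lborel. g' p (1,0)) = 0"
    unfolding eq lborel_pair.integral_snd[OF int', symmetric] by simp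
  have "(LINT z|lborel. g' (y, z) (0,1)) = 0" for y
    using integral_along_line_compact_support[OF d c K, of "(0,1)" "(y,0)"] by (simp add: zero_prod_def)
  then show "(LINT p|lborel. g' p (0,1)) = 0"
    unfolding eq lborel_pair.integral_fst[OF int', symmetric] by simp
qed

section \<open>Orlicz forms on the collar\<close>

definition collar :: "real \<Rightarrow> real \<Rightarrow> plane set" where
  "collar a b = {a..b} \<times> {0..}"

text \<open>
  The modular of \<open>dy\<close> restricted to the collar, since \<open>dy\<close> has norm \<open>exp (- z)\<close>.
\<close>
definition collar_mass :: "(real \<Rightarrow> real) \<Rightarrow> real \<Rightarrow> real \<Rightarrow> ennreal" where
  "collar_mass F a b = (\<integral>\<^sup>+p. ennreal (F (exp (- snd p) * indicator (collar a b) p)) \<partial>hyp_measure)"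

lemma collar_mass_finite:
  assumes "modular_gauge F" "(\<integral>\<^sup>+v\<in>{0<..1}. ennreal (F v / v\<^sup>2) \<partial>lborel) < \<infinity>"
  shows "collar_mass F a b < \<infinity>"
  unfolding collar_mass_def
  by (rule collar_modular_finite[where M = 1 and a = a and b = b])
     (use assms in \<open>auto simp: collar_def indicator_def\<close>)

lemma collar_measurable [measurable]: "collar a b \<in> sets borel"
  unfolding collar_def by (intro borel_closed closed_Times) auto

lemma exp_snd_measurable [measurable]:
  "(\<lambda>p::plane. exp (snd p)) \<in> borel_measurable borel"
  "(\<lambda>p::plane. exp (- snd p)) \<in> borel_measurable borel"
  by (auto intro!: borel_measurable_continuous_onI continuous_intros)

text \<open>
  Young's inequality for \<open>\<bar>\<omega>\<bar> / K\<close> and \<open>exp (- z)\<close>. The density \<open>exp z\<close> cancels \<open>exp (- z)\<close>, so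
  the left side is an integral for \<open>dy dz\<close>. The pointwise norm \<open>\<nu>\<close> is a parameter because the lemma
  serves 0-forms (with \<open>\<Phi>1\<close>) and 1-forms (with \<open>\<Phi>2\<close>); the explicit \<open>K\<close> is what yields continuity
  for the gauge norm.
\<close>
lemma nn_integral_collar_le:
  fixes \<omega> :: "plane \<Rightarrow> 'v::real_normed_vector"
  assumes N: "N_function \<Phi>" and K: "0 < K"
    and nn: "\<And>p x. 0 \<le> \<nu> p x" and sc: "\<And>p x c. \<nu> p (c *\<^sub>R x) = \<bar>c\<bar> * \<nu> p x"
    and [measurable]: "(\<lambda>p. \<nu> p (\<omega> p)) \<in> borel_measurable borel"
  shows "(\<integral>\<^sup>+p\<in>collar a b. ennreal (\<nu> p (\<omega> p)) \<partial>lborel)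
    \<le> ennreal K * (modular hyp_measure \<nu> \<Phi> (\<lambda>p. \<omega> p /\<^sub>R K) + collar_mass (complementary \<Phi>) a b)"
proof -
  let ?x = "\<lambda>p. \<nu> p (\<omega> p) / K" and ?y = "\<lambda>p. exp (- snd p) * indicator (collar a b) p"
  note g = modular_gauge_N_function[OF N] and gc = modular_gauge_complementary[OF N]
  have [measurable]: "(\<lambda>p. \<Phi> (?x p)) \<in> borel_measurable borel"
    by (rule modular_gauge_measurable[OF g]) (use nn K in auto)
  have [measurable]: "(\<lambda>p. complementary \<Phi> (?y p)) \<in> borel_measurable borel"
    by (rule modular_gauge_measurable[OF gc]) auto
  have nn1: "0 \<le> \<Phi> (?x p)" "0 \<le> complementary \<Phi> (?y p)" for p
    using modular_gauge_nonneg[OF g] modular_gauge_nonneg[OF gc] nn K by auto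
  have "(\<integral>\<^sup>+p\<in>collar a b. ennreal (\<nu> p (\<omega> p)) \<partial>lborel)
    \<le> (\<integral>\<^sup>+p. ennreal (exp (snd p)) * (ennreal K * (ennreal (\<Phi> (?x p)) + ennreal (complementary \<Phi> (?y p)))) \<partial>lborel)"
  proof (rule nn_integral_mono)
    fix p
    have "?x p * ?y p \<le> \<Phi> (?x p) + complementary \<Phi> (?y p)"
      by (rule Young_inequality[OF N]) (use nn K in auto)
    then have le: "exp (snd p) * (K * (?x p * ?y p)) \<le> exp (snd p) * (K * (\<Phi> (?x p) + complementary \<Phi> (?y p)))"
      using K by (intro mult_left_mono) auto
    have "\<nu> p (\<omega> p) * indicator (collar a b) p = exp (snd p) * (K * (?x p * ?y p))"
      using K by (simp add: exp_minus)
    also note le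
    finally have "\<nu> p (\<omega> p) * indicator (collar a b) p
      \<le> exp (snd p) * (K * (\<Phi> (?x p) + complementary \<Phi> (?y p)))" .
    then show "ennreal (\<nu> p (\<omega> p)) * indicator (collar a b) p
      \<le> ennreal (exp (snd p)) * (ennreal K * (ennreal (\<Phi> (?x p)) + ennreal (complementary \<Phi> (?y p))))"
      using K nn1[of p] nn[of p "\<omega> p"]
      by (simp flip: ennreal_plus ennreal_mult ennreal_indicator add: ennreal_leI)
  qed
  also have "\<dots> = (\<integral>\<^sup>+p. ennreal K * (ennreal (\<Phi> (?x p)) + ennreal (complementary \<Phi> (?y p))) \<partial>hyp_measure)"
    by (rule nn_integral_hyp_measure[symmetric]) measurable
  also have "\<dots> = ennreal K * (\<integral>\<^sup>+p. ennreal (\<Phi> (?x p)) + ennreal (complementary \<Phi> (?y p)) \<partial>hyp_measure)"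
    by (rule nn_integral_cmult) (simp add: measurable_cong_sets[OF sets_hyp refl])
  also have "(\<integral>\<^sup>+p. ennreal (\<Phi> (?x p)) + ennreal (complementary \<Phi> (?y p)) \<partial>hyp_measure)
     = (\<integral>\<^sup>+p. ennreal (\<Phi> (?x p)) \<partial>hyp_measure) + collar_mass (complementary \<Phi>) a b"
    unfolding collar_mass_def
    by (rule nn_integral_add) (simp_all add: measurable_cong_sets[OF sets_hyp refl])
  also have "(\<lambda>p. ennreal (\<Phi> (?x p))) = (\<lambda>p. ennreal (\<Phi> (\<nu> p (\<omega> p /\<^sub>R K))))"
    using K by (simp add: sc divide_inverse mult.commute)
  finally show ?thesis by (simp add: modular_def)
qed

lemma orlicz_integrable_on_collar:
  fixes \<omega> :: "plane \<Rightarrow> 'v::real_normed_vector"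
  assumes N: "N_function \<Phi>"
    and fin: "(\<integral>\<^sup>+v\<in>{0<..1}. ennreal (complementary \<Phi> v / v\<^sup>2) \<partial>lborel) < \<infinity>"
    and nn: "\<And>p x. 0 \<le> \<nu> p x" and sc: "\<And>p x c. \<nu> p (c *\<^sub>R x) = \<bar>c\<bar> * \<nu> p x"
    and meas [measurable]: "(\<lambda>p. \<nu> p (\<omega> p)) \<in> borel_measurable borel"
    and \<omega>: "\<omega> \<in> orlicz_space hyp_measure \<nu> \<Phi>"
  shows "integrable lborel (\<lambda>p. indicator (collar a b) p * \<nu> p (\<omega> p))"
proof (rule integrableI_bounded)
  obtain \<alpha> where \<alpha>: "0 < \<alpha>" "modular hyp_measure \<nu> \<Phi> (\<lambda>p. \<alpha> *\<^sub>R \<omega> p) < \<infinity>"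
    using \<omega> by (auto simp: orlicz_space_def)
  have "(\<integral>\<^sup>+p. ennreal (norm (indicator (collar a b) p * \<nu> p (\<omega> p))) \<partial>lborel)
    = (\<integral>\<^sup>+p\<in>collar a b. ennreal (\<nu> p (\<omega> p)) \<partial>lborel)"
    using nn by (intro nn_integral_cong) (auto simp: indicator_def)
  also have "\<dots> \<le> ennreal (inverse \<alpha>) * (modular hyp_measure \<nu> \<Phi> (\<lambda>p. \<omega> p /\<^sub>R inverse \<alpha>)
      + collar_mass (complementary \<Phi>) a b)"
    by (rule nn_integral_collar_le[OF N _ nn sc meas]) (use \<alpha> in auto)
  also have "\<dots> < \<infinity>"
    using \<alpha> collar_mass_finite[OF modular_gauge_complementary[OF N] fin]
    by (simp add: ennreal_mult_less_top)
  finally show "(\<integral>\<^sup>+p. ennreal (norm (indicator (collar a b) p * \<nu> p (\<omega> p))) \<partial>lborel) < \<infinity>" .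
qed measurable

section \<open>The closed forms d (\<sigma> U)\<close>

lemma continuous_on_coordinate:
  assumes "continuous_on UNIV f"
  shows "continuous_on UNIV (\<lambda>p::plane. f (fst p))" "continuous_on UNIV (\<lambda>p::plane. f (snd p))"
  by (auto intro!: continuous_on_compose2[OF assms] continuous_intros)

lemma smooth_coordinate_products:
  fixes A B C D :: "real \<Rightarrow> real"
  assumes "smooth A" "smooth B" "smooth C" "smooth D"
  shows "smooth (\<lambda>p::plane. (A (snd p) * B (fst p), C (snd p) * D (fst p)))"
  unfolding smooth_def
proof
  fix k
  note c = assms[unfolded smooth_def, rule_format, of k]
  have "Ck k (\<lambda>p::plane. (A (snd p) *\<^sub>R B (fst p)) *\<^sub>R (1::real, 0::real)
      + (C (snd p) *\<^sub>R D (fst p)) *\<^sub>R (0::real, 1::real))"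
    by (intro Ck_add Ck_scaleR Ck_const Ck_compose_linear[OF bounded_linear_fst]
        Ck_compose_linear[OF bounded_linear_snd] c)
  then show "Ck k (\<lambda>p::plane. (A (snd p) * B (fst p), C (snd p) * D (fst p)))" by simp
qed

lemma product_has_derivative:
  fixes A B :: "real \<Rightarrow> real"
  assumes "smooth A" "smooth B"
  shows "((\<lambda>p::plane. A (snd p) * B (fst p)) has_derivative
    (\<lambda>v. A (snd p) * (deriv B (fst p) * fst v) + deriv A (snd p) * snd v * B (fst p))) (at p)"
proof -
  have A: "(A has_derivative (\<lambda>h. deriv A (snd p) * h)) (at (snd p))"
    and B: "(B has_derivative (\<lambda>h. deriv B (fst p) * h)) (at (fst p))"
    using assms[THEN smooth_real_has_derivative] by (simp_all add: has_field_derivative_def)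
  show ?thesis
    by (rule has_derivative_mult[OF has_derivative_compose[OF has_derivative_snd[OF has_derivative_ident] A]
          has_derivative_compose[OF has_derivative_fst[OF has_derivative_ident] B]])
qed

text \<open>
  A \<open>dy\<close>-component decays by itself. A \<open>dz\<close>-component does not, but if it lives below height 1 then
  \<open>exp (- z) \<ge> 1 / 3\<close> there, whence the constant \<open>1 + 3\<close>.
\<close>
lemma hyp_norm_collar_le:
  assumes "\<bar>fst \<alpha>\<bar> \<le> C" "\<bar>snd \<alpha>\<bar> \<le> C" "snd \<alpha> \<noteq> 0 \<Longrightarrow> snd p \<le> 1" "\<alpha> \<noteq> 0 \<Longrightarrow> p \<in> collar a b"
  shows "hyp_norm p \<alpha> \<le> 4 * C * exp (- snd p) * indicator (collar a b) p"
proof (cases "\<alpha> = 0")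
  case False
  have "\<bar>snd \<alpha>\<bar> \<le> 3 * C * exp (- snd p)"
  proof (cases "snd \<alpha> = 0")
    case False
    have "exp (snd p) \<le> exp 1" using assms(3)[OF False] by simp
    also have "\<dots> \<le> 3" by (rule exp_le)
    finally have "\<bar>snd \<alpha>\<bar> * exp (snd p) \<le> C * 3" using assms(2) by (intro mult_mono) auto
    then show ?thesis by (simp add: exp_minus field_simps)
  qed (use assms(1) in auto)
  moreover have "hyp_norm p \<alpha> \<le> exp (- snd p) * \<bar>fst \<alpha>\<bar> + \<bar>snd \<alpha>\<bar>"
    unfolding norm_hyp using norm_Pair_le[of "exp (- snd p) * fst \<alpha>" "snd \<alpha>"] by (simp add: abs_mult)
  moreover have "exp (- snd p) * \<bar>fst \<alpha>\<bar> \<le> C * exp (- snd p)"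
    using assms(1) by (subst mult.commute) (rule mult_right_mono, auto)
  ultimately have "hyp_norm p \<alpha> \<le> 4 * C * exp (- snd p)" by linarith
  then show ?thesis using assms(4)[OF False] by simp
qed (use assms(1) in \<open>auto simp: norm_hyp zero_prod_def[symmetric] indicator_def\<close>)

lemma abs_wedge11_collar_le:
  assumes "hyp_norm p \<beta> \<le> C * exp (- snd p) * indicator (collar a b) p"
  shows "\<bar>wedge11 \<alpha> \<beta>\<bar> \<le> C * (indicator (collar a b) p * hyp_norm p \<alpha>)"
proof -
  have "\<bar>wedge11 \<alpha> \<beta>\<bar> \<le> exp (snd p) * (hyp_norm p \<alpha> * hyp_norm p \<beta>)" by (rule abs_wedge11_le)
  also have "\<dots> \<le> exp (snd p) * (hyp_norm p \<alpha> * (C * exp (- snd p) * indicator (collar a b) p))"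
    by (intro mult_left_mono assms norm_hyp_nonneg) auto
  also have "\<dots> = C * (indicator (collar a b) p * hyp_norm p \<alpha>)" by (simp add: exp_minus)
  finally show ?thesis .
qed

lemma test_form_d0_eq_0:
  assumes "test_form V \<phi>" "p \<notin> V" shows "d0 \<phi> p = 0"
proof -
  let ?S = "closure {q. \<phi> q \<noteq> 0}"
  have "open (- ?S)" "p \<in> - ?S" "\<And>q. q \<in> - ?S \<Longrightarrow> 0 = \<phi> q"
    using assms closure_subset[of "{q. \<phi> q \<noteq> 0}"] by (auto simp: test_form_def)
  then have "(\<phi> has_derivative (\<lambda>_. 0)) (at p)"
    by (rule has_derivative_transform_within_open[OF has_derivative_const[of 0]])
  then show ?thesis using frechet_derivative_at[of \<phi> "\<lambda>_. 0" p] by (simp add: d0_def zero_prod_def fun_eq_iff)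
qed

lemma wedge11_measurable:
  assumes "f \<in> borel_measurable borel" "g \<in> borel_measurable borel"
  shows "(\<lambda>p. wedge11 (f p) (g p)) \<in> borel_measurable (borel :: plane measure)"
proof -
  have [measurable]: "snd \<in> borel_measurable (borel :: plane measure)" "fst \<in> borel_measurable (borel :: plane measure)"
    by (auto intro!: borel_measurable_continuous_onI continuous_intros)
  note assms[measurable]
  show ?thesis unfolding wedge11_def by measurable
qed

lemma L1_measurable: "\<omega> \<in> L1 hyperbolic_metric \<Phi> \<Longrightarrow> \<omega> \<in> borel_measurable borel"
  unfolding L1_def orlicz_space_def by (simp add: measurable_cong_sets[OF sets_hyp refl])

text \<open>
  The profile of the primitives in the \<open>z\<close>-direction: 0 on one side, where \<open>dy\<close> becomes large,
  and 1 towards the boundary line \<open>z = \<infinity>\<close>.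
\<close>
locale smooth_step =
  fixes \<sigma> :: "real \<Rightarrow> real"
  assumes smooth: "smooth \<sigma>"
    and eq_0: "\<And>z. z \<le> 0 \<Longrightarrow> \<sigma> z = 0" and eq_1: "\<And>z. 1 \<le> z \<Longrightarrow> \<sigma> z = 1"
begin

lemma bump_deriv_step: "bump 0 1 (deriv \<sigma>)"
  unfolding bump_def
proof (intro conjI allI impI)
  show "smooth (deriv \<sigma>)" by (rule smooth_deriv[OF smooth])
  fix z :: real assume "z \<notin> {0..1}"
  then consider "z < 0" | "1 < z" by fastforce
  then show "deriv \<sigma> z = 0"
    using deriv_eq_0_of_locally_const[of "{..<0}" z \<sigma> 0] deriv_eq_0_of_locally_const[of "{1<..}" z \<sigma> 1]
      eq_0 eq_1 by cases auto
qed

lemma deriv_step_eq_0: "z \<notin> {0..1} \<Longrightarrow> deriv \<sigma> z = 0"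
  using bump_deriv_step by (auto simp: bump_def)

lemma step_bounded: obtains C where "1 \<le> C" "\<And>z. \<bar>\<sigma> z\<bar> \<le> C"
proof -
  have "bounded (\<sigma> ` {0..1})"
    by (intro compact_imp_bounded compact_continuous_image continuous_on_subset[OF smooth_continuous[OF smooth]]) auto
  then obtain C where "\<forall>x\<in>\<sigma> ` {0..1}. norm x \<le> C" unfolding bounded_iff by blast
  then have C: "\<And>z. z \<in> {0..1} \<Longrightarrow> \<bar>\<sigma> z\<bar> \<le> C" by simp
  have "\<bar>\<sigma> z\<bar> \<le> max C 1" for z
    using C[of z] eq_0[of z] eq_1[of z] by (cases "z \<in> {0..1}") (auto simp: le_max_iff_disj not_le)
  then show ?thesis by (rule that[rotated]) auto
qed

text \<open>
  The form \<open>d (\<sigma> U)\<close>.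
\<close>
definition step_form :: "(real \<Rightarrow> real) \<Rightarrow> plane \<Rightarrow> plane" where
  "step_form U p = (\<sigma> (snd p) * deriv U (fst p), deriv \<sigma> (snd p) * U (fst p))"

text \<open>
  Only the \<open>dy\<close>-component is cut off: the \<open>dz\<close>-component already has compact support. The result is
  a test form that agrees with \<open>step_form U\<close> where \<open>z \<le> n\<close>.
\<close>
definition step_form_cutoff :: "nat \<Rightarrow> (real \<Rightarrow> real) \<Rightarrow> plane \<Rightarrow> plane" where
  "step_form_cutoff n U p =
     ((\<sigma> (snd p) - \<sigma> (snd p - real n)) * deriv U (fst p), deriv \<sigma> (snd p) * U (fst p))"

text \<open>
  One constant serves the form and all its cutoffs; the dominated convergence in
  \<open>pairing_eq_0_of_exact\<close> depends on this uniformity.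
\<close>
lemma step_form_bounds:
  assumes U: "bump a b U"
  obtains C where "0 < C"
    "\<And>p. hyp_norm p (step_form U p) \<le> C * exp (- snd p) * indicator (collar a b) p"
    "\<And>n p. hyp_norm p (step_form_cutoff n U p) \<le> C * exp (- snd p) * indicator (collar a b) p"
proof -
  obtain S where S: "1 \<le> S" "\<And>z. \<bar>\<sigma> z\<bar> \<le> S" by (rule step_bounded) blast
  obtain S' where S': "0 < S'" "\<And>z. \<bar>deriv \<sigma> z\<bar> \<le> S'" by (rule bump_bounded[OF bump_deriv_step]) blast
  obtain B where B: "0 < B" "\<And>y. \<bar>U y\<bar> \<le> B" by (rule bump_bounded[OF U]) blast
  obtain B' where B': "0 < B'" "\<And>y. \<bar>deriv U y\<bar> \<le> B'" by (rule bump_bounded[OF bump_deriv[OF U]]) blast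
  define C where "C = 2 * S * B' + S' * B"
  have pos: "0 < S * B'" "0 < S' * B" using S(1) S'(1) B(1) B'(1) by auto
  have b1: "\<bar>\<sigma> z * deriv U y\<bar> \<le> C" for y z
  proof -
    have "\<bar>\<sigma> z * deriv U y\<bar> \<le> S * B'"
      unfolding abs_mult using S B' by (intro mult_mono) auto
    then show ?thesis using pos by (simp add: C_def)
  qed
  have b2: "\<bar>(\<sigma> z - \<sigma> (z - real n)) * deriv U y\<bar> \<le> C" for y z n
  proof -
    have "\<bar>\<sigma> z - \<sigma> (z - real n)\<bar> \<le> 2 * S" using S(2)[of z] S(2)[of "z - real n"] by linarith
    then have "\<bar>(\<sigma> z - \<sigma> (z - real n)) * deriv U y\<bar> \<le> 2 * S * B'"
      unfolding abs_mult using S B' by (intro mult_mono) auto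
    then show ?thesis using pos by (simp add: C_def)
  qed
  have b3: "\<bar>deriv \<sigma> z * U y\<bar> \<le> C" for y z
  proof -
    have "\<bar>deriv \<sigma> z * U y\<bar> \<le> S' * B"
      unfolding abs_mult using S' B by (intro mult_mono) auto
    then show ?thesis using pos by (simp add: C_def)
  qed
  have Uz: "U y = 0" "deriv U y = 0" if "y \<notin> {a..b}" for y
    using U bump_deriv[OF U] that by (auto simp: bump_def)
  show ?thesis
  proof (rule that[of "4 * C"])
    show "0 < 4 * C" using pos by (simp add: C_def)
    show "hyp_norm p (step_form U p) \<le> 4 * C * exp (- snd p) * indicator (collar a b) p" for p
    proof (rule hyp_norm_collar_le)
      show "p \<in> collar a b" if "step_form U p \<noteq> 0"
      proof (rule ccontr)
        assume "p \<notin> collar a b"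
        then have "fst p \<notin> {a..b} \<or> snd p < 0" by (cases p) (auto simp: collar_def)
        then show False
          using that Uz eq_0[of "snd p"] deriv_step_eq_0[of "snd p"] by (auto simp: step_form_def zero_prod_def)
      qed
    qed (use b1 b3 deriv_step_eq_0 in \<open>auto simp: step_form_def intro: ccontr\<close>)
    show "hyp_norm p (step_form_cutoff n U p) \<le> 4 * C * exp (- snd p) * indicator (collar a b) p" for n p
    proof (rule hyp_norm_collar_le)
      show "p \<in> collar a b" if "step_form_cutoff n U p \<noteq> 0"
      proof (rule ccontr)
        assume "p \<notin> collar a b"
        then have "fst p \<notin> {a..b} \<or> snd p < 0" by (cases p) (auto simp: collar_def)
        then show False
          using that Uz eq_0[of "snd p"] eq_0[of "snd p - real n"] deriv_step_eq_0[of "snd p"]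
          by (auto simp: step_form_cutoff_def zero_prod_def)
      qed
    qed (use b2 b3 deriv_step_eq_0 in \<open>auto simp: step_form_cutoff_def intro: ccontr\<close>)
  qed
qed

lemma step_form_continuous: "bump a b U \<Longrightarrow> continuous_on UNIV (step_form U)"
  unfolding step_form_def
  by (intro continuous_intros continuous_on_coordinate smooth_continuous smooth smooth_deriv)
     (auto simp: bump_def smooth_deriv)

lemma step_form_L1:
  assumes U: "bump a b U" and N: "N_function \<Phi>"
    and fin: "(\<integral>\<^sup>+v\<in>{0<..1}. ennreal (\<Phi> v / v\<^sup>2) \<partial>lborel) < \<infinity>"
  shows "step_form U \<in> L1 hyperbolic_metric \<Phi>"
proof -
  obtain C where C: "0 < C" "\<And>p. hyp_norm p (step_form U p) \<le> C * exp (- snd p) * indicator (collar a b) p"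
    by (rule step_form_bounds[OF U]) blast
  have "(\<integral>\<^sup>+p. ennreal (\<Phi> (hyp_norm p (step_form U p))) \<partial>hyp_measure) < \<infinity>"
  proof (rule collar_modular_finite[OF modular_gauge_N_function[OF N] C(1) fin])
    show "hyp_norm p (step_form U p) \<le> C * exp (- snd p)" for p
      using C(1) by (intro order.trans[OF C(2)]) (auto simp: indicator_def)
    show "hyp_norm p (step_form U p) = 0" if "p \<notin> {a..b} \<times> {0..}" for p
      using C(2)[of p] norm_hyp_nonneg[of p "step_form U p"] that by (simp add: collar_def)
  qed (rule norm_hyp_nonneg)
  moreover have "step_form U \<in> borel_measurable hyp_measure"
    using borel_measurable_continuous_onI[OF step_form_continuous[OF U]]
    by (simp add: measurable_cong_sets[OF sets_hyp refl])
  ultimately show ?thesis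
    unfolding L1_def orlicz_space_def modular_def by (auto intro!: exI[of _ 1])
qed

text \<open>
  With \<open>g1 = \<sigma> U' \<phi>\<close> and \<open>g2 = \<sigma>' U \<phi>\<close>, the form \<open>d (\<sigma> U) \<and> d\<phi>\<close> has coefficient
  \<open>\<partial>g1/\<partial>z - \<partial>g2/\<partial>y\<close>, because both contain the same term \<open>\<sigma>' U' \<phi>\<close>. Each summand integrates to 0.
\<close>
lemma step_form_closed:
  assumes U: "bump a b U"
  shows "weak_differential1 (step_form U) (\<lambda>_. 0)"
  unfolding weak_differential1_def
proof (intro conjI allI impI)
  show "locally_integrable (step_form U)"
    unfolding locally_integrable_def set_integrable_def
    using step_form_continuous[OF U] by (auto intro!: borel_integrable_compact intro: continuous_on_subset)
  show "locally_integrable (\<lambda>_. 0::real)" by (rule li_0)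
  fix V :: "plane set" and \<phi> :: "plane \<Rightarrow> real" assume V: "open V \<and> connected V" and \<phi>: "test_form V \<phi>"
  have sU: "smooth U" "smooth (deriv U)" and s\<sigma>: "smooth (deriv \<sigma>)"
    using U smooth_deriv smooth by (auto simp: bump_def)
  obtain K where K: "compact K" "continuous_on UNIV \<phi>" "\<And>p. p \<notin> K \<Longrightarrow> \<phi> p = 0" "\<And>p. \<phi> differentiable at p"
    "\<And>v. continuous_on UNIV (\<lambda>p. frechet_derivative \<phi> (at p) v)" "\<And>p v. p \<notin> K \<Longrightarrow> frechet_derivative \<phi> (at p) v = 0"
    by (rule test_D[OF \<phi>]; rule that; assumption)
  have d\<phi>: "(\<phi> has_derivative frechet_derivative \<phi> (at p)) (at p)" for p
    using K(4) by (simp only: frechet_derivative_works)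
  let ?g1 = "\<lambda>p v. \<sigma> (snd p) * deriv U (fst p) * frechet_derivative \<phi> (at p) v
    + (\<sigma> (snd p) * (deriv (deriv U) (fst p) * fst v) + deriv \<sigma> (snd p) * snd v * deriv U (fst p)) * \<phi> p"
  let ?g2 = "\<lambda>p v. deriv \<sigma> (snd p) * U (fst p) * frechet_derivative \<phi> (at p) v
    + (deriv \<sigma> (snd p) * (deriv U (fst p) * fst v) + deriv (deriv \<sigma>) (snd p) * snd v * U (fst p)) * \<phi> p"
  note cont = continuous_on_coordinate[OF smooth_continuous[OF smooth]] continuous_on_coordinate[OF smooth_continuous[OF s\<sigma>]]
    continuous_on_coordinate[OF smooth_continuous[OF smooth_deriv[OF s\<sigma>]]]
    continuous_on_coordinate[OF smooth_continuous[OF sU(1)]] continuous_on_coordinate[OF smooth_continuous[OF sU(2)]]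
    continuous_on_coordinate[OF smooth_continuous[OF smooth_deriv[OF sU(2)]]] K(2,5)
  have g1: "integrable lborel (\<lambda>p. ?g1 p v)" "(LINT p|lborel. ?g1 p (0,1)) = 0" for v
    by (rule integral_partial_compact_support[OF has_derivative_mult[OF product_has_derivative[OF smooth sU(2)] d\<phi>] _ K(1)];
        (intro continuous_intros cont | simp add: K(3)))+
  have g2: "integrable lborel (\<lambda>p. ?g2 p v)" "(LINT p|lborel. ?g2 p (1,0)) = 0" for v
    by (rule integral_partial_compact_support[OF has_derivative_mult[OF product_has_derivative[OF s\<sigma> sU(1)] d\<phi>] _ K(1)];
        (intro continuous_intros cont | simp add: K(3)))+
  have "(LINT p:V|lborel. wedge11 (step_form U p) (d0 \<phi> p)) = (LINT p|lborel. wedge11 (step_form U p) (d0 \<phi> p))"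
    unfolding set_lebesgue_integral_def using test_form_d0_eq_0[OF \<phi>]
    by (intro Bochner_Integration.integral_cong refl) (auto simp: indicator_def wedge11_def)
  also have "\<dots> = (LINT p|lborel. ?g1 p (0,1) - ?g2 p (1,0))"
    by (intro Bochner_Integration.integral_cong refl) (simp add: wedge11_def step_form_def d0_def algebra_simps)
  also have "\<dots> = 0"
    by (subst Bochner_Integration.integral_diff[OF g1(1) g2(1)]) (simp only: g1(2) g2(2) diff_self)
  finally show "(LINT p:V|lborel. wedge11 (step_form U p) (d0 \<phi> p)) = (LINT p:V|lborel. 0 * \<phi> p)"
    by (simp add: set_lebesgue_integral_def)
qed

end

context smooth_step begin

section \<open>The functionals and their vanishing on exact forms\<close>

definition pairing :: "(real \<Rightarrow> real) \<Rightarrow> (plane \<Rightarrow> plane) \<Rightarrow> real" where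
  "pairing W \<theta> = (LINT p|lborel. wedge11 (\<theta> p) (step_form W p))"

lemma pairing_scaleR: "pairing W (\<lambda>p. c *\<^sub>R f p) = c * pairing W f"
  unfolding pairing_def w_sc by simp

end

context
  fixes \<Phi> :: "real \<Rightarrow> real"
  assumes N: "N_function \<Phi>"
    and fin: "(\<integral>\<^sup>+v\<in>{0<..1}. ennreal (complementary \<Phi> v / v\<^sup>2) \<partial>lborel) < \<infinity>"
begin

lemma L1_integrable_on_collar:
  assumes "\<theta> \<in> L1 hyperbolic_metric \<Phi>"
  shows "integrable lborel (\<lambda>p. indicator (collar a b) p * hyp_norm p (\<theta> p))"
  using assms unfolding L1_def
  by (intro orlicz_integrable_on_collar[OF N fin norm_hyp_nonneg norm_hyp_scale])
     (auto intro!: norm_hyp_meas L1_measurable simp: L1_def)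

lemma L0_integrable_on_collar:
  assumes "\<beta> \<in> L0 hyperbolic_metric \<Phi>"
  shows "integrable lborel (\<lambda>p. indicator (collar a b) p * \<bar>\<beta> p\<bar>)"
proof -
  have "\<beta> \<in> borel_measurable borel"
    using assms unfolding L0_def orlicz_space_def by (simp add: measurable_cong_sets[OF sets_hyp refl])
  then show ?thesis
    using orlicz_integrable_on_collar[OF N fin, of form_norm0 \<beta> a b] assms
    by (simp add: L0_def form_norm0_def abs_mult)
qed

text \<open>
  On the collar \<open>\<bar>\<theta> \<and> \<eta>\<bar>\<close> is at most a constant times \<open>\<bar>\<theta>\<bar>\<close>, which is integrable there.
\<close>
lemma wedge11_integrable:
  assumes \<theta>: "\<theta> \<in> L1 hyperbolic_metric \<Phi>" and \<eta>: "\<eta> \<in> borel_measurable borel"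
    "\<And>p. hyp_norm p (\<eta> p) \<le> C * exp (- snd p) * indicator (collar a b) p"
  shows "integrable lborel (\<lambda>p. wedge11 (\<theta> p) (\<eta> p))"
proof (rule Bochner_Integration.integrable_bound)
  show "integrable lborel (\<lambda>p. C * (indicator (collar a b) p * hyp_norm p (\<theta> p)))"
    by (intro integrable_mult_right L1_integrable_on_collar \<theta>)
  show "(\<lambda>p. wedge11 (\<theta> p) (\<eta> p)) \<in> borel_measurable lborel"
    using wedge11_measurable[OF L1_measurable[OF \<theta>] \<eta>(1)] by simp
  show "AE p in lborel. norm (wedge11 (\<theta> p) (\<eta> p)) \<le> norm (C * (indicator (collar a b) p * hyp_norm p (\<theta> p)))"
    unfolding real_norm_def
    by (intro AE_I2 order.trans[OF abs_wedge11_collar_le[OF \<eta>(2)] abs_ge_self])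
qed

context
  fixes \<sigma> a b W assumes step: "smooth_step \<sigma>" and W: "bump a b W"
begin

interpretation smooth_step \<sigma> by (rule step)

lemma pairing_integrable:
  assumes \<theta>: "\<theta> \<in> L1 hyperbolic_metric \<Phi>"
  shows "integrable lborel (\<lambda>p. wedge11 (\<theta> p) (step_form W p))"
proof -
  obtain C where "\<And>p. hyp_norm p (step_form W p) \<le> C * exp (- snd p) * indicator (collar a b) p"
    by (rule step_form_bounds[OF W]) blast
  then show ?thesis
    by (intro wedge11_integrable \<theta> borel_measurable_continuous_onI step_form_continuous[OF W])
qed

lemma pairing_add:
  assumes "f \<in> L1 hyperbolic_metric \<Phi>" "h \<in> L1 hyperbolic_metric \<Phi>"
  shows "pairing W (\<lambda>p. f p + h p) = pairing W f + pairing W h"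
  unfolding pairing_def w_add
  by (intro Bochner_Integration.integral_add pairing_integrable assms)

text \<open>
  Continuity of the functional, stated through the sets that define the gauge norm.
\<close>
lemma pairing_le_modular:
  obtains M where "0 < M" "\<And>\<theta> K. \<theta> \<in> L1 hyperbolic_metric \<Phi> \<Longrightarrow> 0 < K \<Longrightarrow>
    modular hyp_measure hyp_norm \<Phi> (\<lambda>p. \<theta> p /\<^sub>R K) \<le> 1 \<Longrightarrow> \<bar>pairing W \<theta>\<bar> \<le> M * K"
proof -
  obtain C where C: "0 < C" "\<And>p. hyp_norm p (step_form W p) \<le> C * exp (- snd p) * indicator (collar a b) p"
    by (rule step_form_bounds[OF W]) blast
  obtain m where m: "collar_mass (complementary \<Phi>) a b = ennreal m" "0 \<le> m"
    using collar_mass_finite[OF modular_gauge_complementary[OF N] fin, of a b]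
    by (cases "collar_mass (complementary \<Phi>) a b") auto
  have "\<bar>pairing W \<theta>\<bar> \<le> (C * (1 + m)) * K"
    if \<theta>: "\<theta> \<in> L1 hyperbolic_metric \<Phi>" and K: "0 < K"
      and mod: "modular hyp_measure hyp_norm \<Phi> (\<lambda>p. \<theta> p /\<^sub>R K) \<le> 1" for \<theta> K
  proof -
    let ?h = "\<lambda>p. indicator (collar a b) p * hyp_norm p (\<theta> p)"
    have "(\<integral>\<^sup>+p. ennreal (?h p) \<partial>lborel) = (\<integral>\<^sup>+p\<in>collar a b. ennreal (hyp_norm p (\<theta> p)) \<partial>lborel)"
      by (intro nn_integral_cong) (auto simp: indicator_def)
    also have "\<dots> \<le> ennreal K * (modular hyp_measure hyp_norm \<Phi> (\<lambda>p. \<theta> p /\<^sub>R K)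
        + collar_mass (complementary \<Phi>) a b)"
      by (intro nn_integral_collar_le[OF N K norm_hyp_nonneg norm_hyp_scale] norm_hyp_meas L1_measurable[OF \<theta>])
    also have "\<dots> \<le> ennreal K * (1 + ennreal m)"
      unfolding m(1) by (intro mult_left_mono add_right_mono mod) auto
    also have "\<dots> = ennreal (K * (1 + m))"
      using K m(2) by (simp add: ennreal_mult ennreal_plus[symmetric] del: ennreal_plus flip: ennreal_1)
    finally have h: "(LINT p|lborel. ?h p) \<le> K * (1 + m)"
      using K m(2) norm_hyp_nonneg by (intro integral_real_bounded) auto
    have "\<bar>pairing W \<theta>\<bar> \<le> (LINT p|lborel. \<bar>wedge11 (\<theta> p) (step_form W p)\<bar>)"
      unfolding pairing_def by (rule integral_abs_bound)
    also have "\<dots> \<le> (LINT p|lborel. C * ?h p)"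
      by (intro integral_mono integrable_abs pairing_integrable integrable_mult_right
          L1_integrable_on_collar \<theta> abs_wedge11_collar_le C(2))
    also have "\<dots> = C * (LINT p|lborel. ?h p)" by simp
    also have "\<dots> \<le> C * (K * (1 + m))" using h C(1) by simp
    finally show ?thesis by (simp add: ac_simps)
  qed
  moreover have "0 < C * (1 + m)" using C(1) m(2) by simp
  ultimately show ?thesis using that by blast
qed

end

end

context smooth_step begin

lemma smooth_step_minus_shift: "smooth (\<lambda>z. \<sigma> z - \<sigma> (z - real n))"
proof -
  have "Ck k (\<lambda>z. \<sigma> z + (- 1) *\<^sub>R \<sigma> (z + - real n))" for k
    using smooth unfolding smooth_def by (intro Ck_add Ck_scaleR Ck_const Ck_translate) auto
  then show ?thesis by (simp add: smooth_def)
qed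

lemma step_form_cutoff_test_form:
  assumes W: "bump a b W" shows "test_form UNIV (step_form_cutoff n W)"
proof -
  have s: "smooth (step_form_cutoff n W)"
    unfolding step_form_cutoff_def
    by (rule smooth_coordinate_products[OF smooth_step_minus_shift]) (use W smooth in \<open>auto simp: bump_def smooth_deriv\<close>)
  have "{p. step_form_cutoff n W p \<noteq> 0} \<subseteq> {a..b} \<times> {0..real n + 1}" (is "?S \<subseteq> ?K")
  proof
    fix p assume "p \<in> ?S"
    then show "p \<in> ?K"
      using W bump_deriv[OF W] deriv_step_eq_0[of "snd p"] eq_0[of "snd p"] eq_0[of "snd p - real n"]
        eq_1[of "snd p"] eq_1[of "snd p - real n"]
      by (cases p) (force simp: bump_def step_form_cutoff_def zero_prod_def)
  qed
  moreover have "compact ?K" by (intro compact_Times compact_Icc)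
  ultimately have "compact (closure ?S)"
    by (meson bounded_subset compact_closure compact_imp_bounded)
  with s show ?thesis by (simp add: test_form_def)
qed

text \<open>
  The differential of a closed form that was cut off only sees the cutoff function: here the terms
  \<open>\<sigma>' W'\<close> cancel, and what is left moves to infinity with \<open>n\<close>.
\<close>
lemma d1_step_form_cutoff:
  assumes W: "bump a b W"
  shows "d1 (step_form_cutoff n W) p = deriv \<sigma> (snd p - real n) * deriv W (fst p)"
proof -
  define A where "A z = \<sigma> z - \<sigma> (z - real n)" for z
  have sA: "smooth A" unfolding A_def[abs_def] by (rule smooth_step_minus_shift)
  have "((\<lambda>z. \<sigma> (z + - real n)) has_real_derivative deriv \<sigma> (z + - real n)) (at z)" for z
    by (rule DERIV_shift[THEN iffD1, OF smooth_real_has_derivative[OF smooth]])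
  then have "(A has_real_derivative deriv \<sigma> z - deriv \<sigma> (z - real n)) (at z)" for z
    unfolding A_def[abs_def]
    by (intro DERIV_diff smooth_real_has_derivative[OF smooth]) simp
  then have dA: "deriv A z = deriv \<sigma> z - deriv \<sigma> (z - real n)" for z by (rule DERIV_imp_deriv)
  have sW: "smooth W" "smooth (deriv W)" "smooth (deriv \<sigma>)"
    using W smooth_deriv smooth by (auto simp: bump_def)
  have e: "(\<lambda>q. fst (step_form_cutoff n W q)) = (\<lambda>q. A (snd q) * deriv W (fst q))"
    "(\<lambda>q. snd (step_form_cutoff n W q)) = (\<lambda>q. deriv \<sigma> (snd q) * W (fst q))"
    by (simp_all add: step_form_cutoff_def A_def)
  show ?thesis
    unfolding d1_def e
      frechet_derivative_at[OF product_has_derivative[OF sA sW(2)], symmetric]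
      frechet_derivative_at[OF product_has_derivative[OF sW(3,1)], symmetric]
    by (simp add: dA algebra_simps)
qed

text \<open>
  Use the cutoffs as test forms in the weak equation \<open>d\<beta> = \<theta>\<close> and let \<open>n\<close> tend to infinity. Both
  sides converge by dominated convergence: the side of \<open>\<theta>\<close> to the pairing, and the side of \<open>\<beta>\<close> to 0,
  because its integrand lives in \<open>n \<le> z \<le> n + 1\<close> and is dominated by a multiple of \<open>\<bar>\<beta>\<bar>\<close> on the
  collar.
\<close>
lemma pairing_eq_0_of_exact:
  assumes W: "bump a b W" and N: "N_function \<Phi>1" "N_function \<Phi>2"
    and fin1: "(\<integral>\<^sup>+v\<in>{0<..1}. ennreal (complementary \<Phi>1 v / v\<^sup>2) \<partial>lborel) < \<infinity>"
    and fin2: "(\<integral>\<^sup>+v\<in>{0<..1}. ennreal (complementary \<Phi>2 v / v\<^sup>2) \<partial>lborel) < \<infinity>"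
    and \<theta>: "\<theta> \<in> B1 hyperbolic_metric \<Phi>1 \<Phi>2"
  shows "pairing W \<theta> = 0"
proof -
  obtain \<beta> where \<theta>L: "\<theta> \<in> L1 hyperbolic_metric \<Phi>2" and \<beta>: "\<beta> \<in> L0 hyperbolic_metric \<Phi>1"
    and d: "weak_differential0 \<beta> \<theta>"
    using \<theta> by (auto simp: B1_def)
  have sW: "smooth W" "smooth (deriv W)" "smooth (deriv \<sigma>)"
    using W smooth_deriv smooth by (auto simp: bump_def)
  obtain C where C: "0 < C" "\<And>p. hyp_norm p (step_form W p) \<le> C * exp (- snd p) * indicator (collar a b) p"
    "\<And>n p. hyp_norm p (step_form_cutoff n W p) \<le> C * exp (- snd p) * indicator (collar a b) p"
    by (rule step_form_bounds[OF W]) blast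
  have cut_meas: "step_form_cutoff n W \<in> borel_measurable borel" for n
    using step_form_cutoff_test_form[OF W, of n]
    by (intro borel_measurable_continuous_onI smooth_continuous) (simp add: test_form_def)
  have step_meas: "step_form W \<in> borel_measurable borel"
    by (intro borel_measurable_continuous_onI step_form_continuous[OF W])
  have "(\<lambda>n. LINT p|lborel. wedge11 (\<theta> p) (step_form_cutoff n W p)) \<longlonglongrightarrow> pairing W \<theta>"
    unfolding pairing_def
  proof (rule integral_dominated_convergence[where w = "\<lambda>p. C * (indicator (collar a b) p * hyp_norm p (\<theta> p))"])
    show "integrable lborel (\<lambda>p. C * (indicator (collar a b) p * hyp_norm p (\<theta> p)))"
      by (intro integrable_mult_right L1_integrable_on_collar[OF N(2) fin2] \<theta>L)
    show "AE p in lborel. (\<lambda>n. wedge11 (\<theta> p) (step_form_cutoff n W p)) \<longlonglongrightarrow> wedge11 (\<theta> p) (step_form W p)"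
    proof (intro AE_I2 tendsto_eventually eventually_sequentiallyI)
      fix p :: plane and n assume "nat \<lceil>snd p\<rceil> \<le> n"
      then have "snd p - real n \<le> 0" by linarith
      then show "wedge11 (\<theta> p) (step_form_cutoff n W p) = wedge11 (\<theta> p) (step_form W p)"
        by (simp add: step_form_cutoff_def step_form_def eq_0)
    qed
    show "AE p in lborel. norm (wedge11 (\<theta> p) (step_form_cutoff n W p)) \<le> C * (indicator (collar a b) p * hyp_norm p (\<theta> p))" for n
      using abs_wedge11_collar_le[OF C(3)] by auto
  qed (use wedge11_measurable L1_measurable[OF \<theta>L] cut_meas step_meas in auto)
  moreover have "(\<lambda>n. LINT p|lborel. \<beta> p * d1 (step_form_cutoff n W) p) \<longlonglongrightarrow> (LINT p|(lborel::plane measure). 0)"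
  proof -
    obtain S' where S': "0 < S'" "\<And>z. \<bar>deriv \<sigma> z\<bar> \<le> S'" by (rule bump_bounded[OF bump_deriv_step]) blast
    obtain B where B: "0 < B" "\<And>y. \<bar>deriv W y\<bar> \<le> B" by (rule bump_bounded[OF bump_deriv[OF W]]) blast
    have le: "\<bar>d1 (step_form_cutoff n W) p\<bar> \<le> S' * B * indicator (collar a b) p" for n p
    proof (cases "p \<in> collar a b")
      case True
      then show ?thesis
        unfolding d1_step_form_cutoff[OF W] abs_mult using S' B by (auto intro: mult_mono)
    next
      case False
      then have "fst p \<notin> {a..b} \<or> snd p - real n \<notin> {0..1}" by (cases p) (auto simp: collar_def)
      then show ?thesis
        using bump_deriv[OF W] deriv_step_eq_0 S'(1) B(1) by (auto simp: d1_step_form_cutoff[OF W] bump_def)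
    qed
    have \<beta>m: "\<beta> \<in> borel_measurable borel"
      using \<beta> unfolding L0_def orlicz_space_def by (simp add: measurable_cong_sets[OF sets_hyp refl])
    have shift: "continuous_on UNIV (\<lambda>z. deriv \<sigma> (z - real n))" for n
      by (rule continuous_on_compose2[OF smooth_continuous[OF sW(3)]]) (auto intro!: continuous_intros)
    have dm: "d1 (step_form_cutoff n W) \<in> borel_measurable borel" for n
      unfolding d1_step_form_cutoff[OF W, abs_def]
      by (intro borel_measurable_continuous_onI continuous_intros continuous_on_coordinate smooth_continuous sW shift)
    show ?thesis
    proof (rule integral_dominated_convergence[where w = "\<lambda>p. S' * B * (indicator (collar a b) p * \<bar>\<beta> p\<bar>)"])
      show "integrable lborel (\<lambda>p. S' * B * (indicator (collar a b) p * \<bar>\<beta> p\<bar>))"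
        by (intro integrable_mult_right L0_integrable_on_collar[OF N(1) fin1] \<beta>)
      show "AE p in lborel. (\<lambda>n. \<beta> p * d1 (step_form_cutoff n W) p) \<longlonglongrightarrow> 0"
      proof (intro AE_I2 tendsto_eventually eventually_sequentiallyI)
        fix p :: plane and n assume "nat \<lceil>snd p\<rceil> + 1 \<le> n"
        then have "snd p - real n \<notin> {0..1}" by (auto simp: not_le) linarith
        then show "\<beta> p * d1 (step_form_cutoff n W) p = 0"
          by (simp add: d1_step_form_cutoff[OF W] deriv_step_eq_0)
      qed
      show "AE p in lborel. norm (\<beta> p * d1 (step_form_cutoff n W) p) \<le> S' * B * (indicator (collar a b) p * \<bar>\<beta> p\<bar>)" for n
      proof (rule AE_I2)
        fix p
        show "norm (\<beta> p * d1 (step_form_cutoff n W) p) \<le> S' * B * (indicator (collar a b) p * \<bar>\<beta> p\<bar>)"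
          using mult_left_mono[OF le[of n p], of "\<bar>\<beta> p\<bar>"] by (simp add: abs_mult ac_simps)
      qed
    qed (use \<beta>m dm in auto)
  qed
  moreover have "(LINT p|lborel. \<beta> p * d1 (step_form_cutoff n W) p)
      = - (LINT p|lborel. wedge11 (\<theta> p) (step_form_cutoff n W p))" for n
    using d step_form_cutoff_test_form[OF W, of n] unfolding weak_differential0_def
    by (auto simp: set_lebesgue_integral_def dest!: spec[of _ UNIV])
  ultimately have "(\<lambda>n. LINT p|lborel. wedge11 (\<theta> p) (step_form_cutoff n W p)) \<longlonglongrightarrow> pairing W \<theta>"
    "(\<lambda>n. - (LINT p|lborel. wedge11 (\<theta> p) (step_form_cutoff n W p))) \<longlonglongrightarrow> 0" by simp_all
  from LIMSEQ_unique[OF tendsto_minus[OF this(1)] this(2)] show ?thesis by simp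
qed

text \<open>
  An exact form closer to \<open>\<omega>\<close> than \<open>\<bar>pairing W \<omega>\<bar> / M\<close> would contradict the bound \<open>M\<close> of the
  functional, which cannot distinguish \<open>\<omega>\<close> from its difference to that exact form.
\<close>
lemma pairing_eq_0_of_closure:
  assumes W: "bump a b W" and N: "N_function \<Phi>1" "N_function \<Phi>2"
    and fin1: "(\<integral>\<^sup>+v\<in>{0<..1}. ennreal (complementary \<Phi>1 v / v\<^sup>2) \<partial>lborel) < \<infinity>"
    and fin2: "(\<integral>\<^sup>+v\<in>{0<..1}. ennreal (complementary \<Phi>2 v / v\<^sup>2) \<partial>lborel) < \<infinity>"
    and \<omega>: "\<omega> \<in> B1_closure hyperbolic_metric \<Phi>1 \<Phi>2"
  shows "pairing W \<omega> = 0"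
proof (rule ccontr)
  assume ne: "pairing W \<omega> \<noteq> 0"
  obtain M where M: "0 < M" "\<And>\<theta> K. \<theta> \<in> L1 hyperbolic_metric \<Phi>2 \<Longrightarrow> 0 < K \<Longrightarrow>
    modular hyp_measure hyp_norm \<Phi>2 (\<lambda>p. \<theta> p /\<^sub>R K) \<le> 1 \<Longrightarrow> \<bar>pairing W \<theta>\<bar> \<le> M * K"
    by (rule pairing_le_modular[OF N(2) fin2 smooth_step_axioms W]) blast
  define \<epsilon> where "\<epsilon> = \<bar>pairing W \<omega>\<bar> / M"
  have "0 < \<epsilon>" using M(1) ne by (simp add: \<epsilon>_def)
  then obtain \<eta> where \<eta>: "\<eta> \<in> B1 hyperbolic_metric \<Phi>1 \<Phi>2"
    "gauge_norm hyp_measure hyp_norm \<Phi>2 (\<lambda>p. \<omega> p - \<eta> p) < \<epsilon>"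
    using \<omega> unfolding B1_closure_def by blast
  have L: "\<omega> \<in> L1 hyperbolic_metric \<Phi>2" "\<eta> \<in> L1 hyperbolic_metric \<Phi>2"
    using \<omega> \<eta> by (auto simp: B1_closure_def B1_def)
  have diff: "(\<lambda>p. \<omega> p + (- 1) *\<^sub>R \<eta> p) \<in> L1 hyperbolic_metric \<Phi>2"
    by (intro lin_add[OF lin_L1] lin_smult[OF lin_L1] L N(2))
  obtain K where K: "0 < K" "K < \<epsilon>" "modular hyp_measure hyp_norm \<Phi>2 (\<lambda>p. (\<omega> p + (- 1) *\<^sub>R \<eta> p) /\<^sub>R K) \<le> 1"
    using GN_lessD[OF N(2) sets_hyp norm_hyp_nonneg norm_hyp_scale norm_hyp_add norm_hyp_meas,
        of "\<lambda>p. \<omega> p + (- 1) *\<^sub>R \<eta> p" \<epsilon>] diff \<eta>(2) by (auto simp: L1_def)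
  have "pairing W \<omega> = pairing W (\<lambda>p. \<omega> p + (- 1) *\<^sub>R \<eta> p)"
    using pairing_add[OF N(2) fin2 smooth_step_axioms W L(1) lin_smult[OF lin_L1[OF N(2)] L(2)], of "- 1"]
      pairing_scaleR[of W "- 1" \<eta>]
      pairing_eq_0_of_exact[OF W N fin1 fin2 \<eta>(1)] by simp
  then have "\<bar>pairing W \<omega>\<bar> \<le> M * K" using M(2)[OF diff K(1,3)] by simp
  also have "\<dots> < M * \<epsilon>" using K(2) M(1) by simp
  also have "\<dots> = \<bar>pairing W \<omega>\<bar>" using M(1) by (simp add: \<epsilon>_def)
  finally show False by simp
qed

section \<open>Values on the closed forms\<close>

lemma pairing_eq_0_of_disjoint:
  assumes U: "bump a b U" and W: "bump c d W" and disj: "b < c \<or> d < a"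
  shows "pairing W (step_form U) = 0"
proof -
  have "wedge11 (step_form U p) (step_form W p) = 0" for p
  proof (cases "fst p \<in> {a..b}")
    case True
    then have "W (fst p) = 0" "deriv W (fst p) = 0"
      using W bump_deriv[OF W] disj by (auto simp: bump_def)
    then show ?thesis by (simp add: wedge11_def step_form_def)
  next
    case False
    then have "U (fst p) = 0" "deriv U (fst p) = 0"
      using U bump_deriv[OF U] by (auto simp: bump_def)
    then show ?thesis by (simp add: wedge11_def step_form_def)
  qed
  then show ?thesis by (simp add: pairing_def)
qed

lemma integral_step_times_deriv: "(LINT z|lborel. \<sigma> z * deriv \<sigma> z) = 1 / 2"
proof -
  note D = smooth_real_has_derivative[OF smooth]
  have c: "continuous_on UNIV \<sigma>" "continuous_on UNIV (deriv \<sigma>)"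
    by (intro smooth_continuous smooth smooth_deriv)+
  have "(LINT z|lborel. \<sigma> z * deriv \<sigma> z) = (LINT z|lborel. \<sigma> z * deriv \<sigma> z * indicator {0..1} z)"
    using deriv_step_eq_0 by (intro Bochner_Integration.integral_cong refl) (auto simp: indicator_def)
  also have "\<dots> = (\<sigma> 1)\<^sup>2 / 2 - (\<sigma> 0)\<^sup>2 / 2"
    using c by (intro integral_FTC_Icc_real) (auto intro!: derivative_eq_intros D continuous_intros
        simp: continuous_on_eq_continuous_at)
  also have "\<dots> = 1 / 2" by (simp add: eq_0 eq_1)
  finally show ?thesis .
qed

lemma integral_deriv_squared_pos:
  assumes W: "bump a b W" and ne: "W y \<noteq> 0"
  shows "(LINT y|lborel. (deriv W y)\<^sup>2) > 0"
proof -
  have sW: "smooth W" "smooth (deriv W)" using W smooth_deriv by (auto simp: bump_def)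
  note bW = bump_deriv[OF W]
  have c: "continuous_on UNIV (\<lambda>y. (deriv W y)\<^sup>2)"
    by (intro continuous_intros smooth_continuous sW)
  have int: "integrable lborel (\<lambda>y. (deriv W y)\<^sup>2)"
    using bW by (intro lborel_integrable_of_compact_support[OF c compact_Icc[of a b]]) (auto simp: bump_def)
  have "(LINT y|lborel. (deriv W y)\<^sup>2) \<noteq> 0"
  proof
    assume 0: "(LINT y|lborel. (deriv W y)\<^sup>2) = 0"
    then have "AE y in lborel. (deriv W y)\<^sup>2 = 0"
      using integral_nonneg_eq_0_iff_AE[OF int] by simp
    then have *: "(LINT y|lborel. (deriv W y)\<^sup>2 * indicator {c..d} y) = 0" for c d
      by (intro integral_eq_zero_AE) auto
    have zero: "deriv W x = 0" for x
    proof -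
      have "set_integrable lborel {x - 1..x + 1} (\<lambda>y. (deriv W y)\<^sup>2)"
        unfolding set_integrable_def
        by (intro borel_integrable_compact continuous_on_subset[OF c]) auto
      note s = set_borel_integral_eq_integral[OF this]
      have "integral {x - 1..x + 1} (\<lambda>y. (deriv W y)\<^sup>2) = 0"
        using s(2) *[of "x - 1" "x + 1"] by (simp add: set_lebesgue_integral_def mult.commute)
      then have "((\<lambda>y. (deriv W y)\<^sup>2) has_integral 0) (cbox (x - 1) (x + 1))"
        using s(1) by (metis has_integral_integral cbox_interval)
      from has_integral_0_cbox_imp_0[OF continuous_on_subset[OF c subset_UNIV] _ this, of x]
      show ?thesis by simp
    qed
    have "W y = W (a - 1)"
      using smooth_real_has_derivative[OF sW(1)] zero by (intro DERIV_isconst_all) simp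
    then show False using ne W by (auto simp: bump_def)
  qed
  moreover have "0 \<le> (LINT y|lborel. (deriv W y)\<^sup>2)"
    by (rule Bochner_Integration.integral_nonneg) simp
  ultimately show ?thesis by linarith
qed

text \<open>
  For any bump \<open>U\<close>, \<open>d (\<sigma> U) \<and> d (\<sigma> W)\<close> has coefficient \<open>\<sigma> \<sigma>' (U' W - U W')\<close>. Since
  \<open>\<sigma> \<sigma>' (U W)'\<close> integrates to 0, its integral is that of \<open>- 2 \<sigma> \<sigma>' U W'\<close>, which is minus the
  integral of \<open>U W'\<close> because \<open>\<sigma> \<sigma>'\<close> integrates to \<open>1 / 2\<close>. The choice \<open>U = W'\<close> makes it
  negative.
\<close>
lemma pairing_deriv_neq_0:
  assumes W: "bump a b W" and ne: "W y \<noteq> 0"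
  shows "pairing W (step_form (deriv W)) \<noteq> 0"
proof -
  let ?U = "deriv W"
  have U: "bump a b ?U" by (rule bump_deriv[OF W])
  have sW: "smooth W" "smooth ?U" "smooth (deriv ?U)" and s\<sigma>: "smooth (deriv \<sigma>)"
    using W smooth_deriv smooth by (auto simp: bump_def)
  note cont = continuous_on_coordinate[OF smooth_continuous[OF smooth]] continuous_on_coordinate[OF smooth_continuous[OF s\<sigma>]]
    continuous_on_coordinate[OF smooth_continuous[OF smooth_deriv[OF s\<sigma>]]]
    continuous_on_coordinate[OF smooth_continuous[OF sW(1)]] continuous_on_coordinate[OF smooth_continuous[OF sW(2)]]
    continuous_on_coordinate[OF smooth_continuous[OF sW(3)]]
  define A where "A z = \<sigma> z * deriv \<sigma> z" for z
  define B where "B y = ?U y * W y" for y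
  have "Ck k (\<lambda>z. \<sigma> z *\<^sub>R deriv \<sigma> z)" "Ck k (\<lambda>y. ?U y *\<^sub>R W y)" for k
    using sW smooth s\<sigma> unfolding smooth_def by (intro Ck_scaleR; simp)+
  then have sAB: "smooth A" "smooth B" by (simp_all add: smooth_def A_def[abs_def] B_def[abs_def])
  have dB: "deriv B y = ?U y * ?U y + deriv ?U y * W y" for y
    unfolding B_def
    by (rule DERIV_imp_deriv, rule DERIV_mult') (intro smooth_real_has_derivative sW)+
  let ?K = "{a..b} \<times> {0..1::real}"
  have K: "compact ?K" by (intro compact_Times compact_Icc)
  have z: "A (snd p) * B (fst p) = 0" if "p \<notin> ?K" for p
    using that W deriv_step_eq_0 by (cases p) (auto simp: A_def B_def bump_def)
  let ?g = "\<lambda>p v. A (snd p) * (deriv B (fst p) * fst v) + deriv A (snd p) * snd v * B (fst p)"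
  note st = integral_partial_compact_support[OF product_has_derivative[OF sAB] _ K z]
  have c: "continuous_on UNIV (\<lambda>p. ?g p v)" for v
    by (intro continuous_intros continuous_on_coordinate smooth_continuous sAB smooth_deriv)
  have g: "integrable lborel (\<lambda>p. ?g p (1,0))" "(LINT p|lborel. ?g p (1,0)) = 0"
    using st(1)[OF c] st(2)[OF c] by blast+
  have ci: "continuous_on UNIV (\<lambda>p::plane. A (snd p) * (?U (fst p))\<^sup>2)"
    by (intro continuous_intros continuous_on_coordinate smooth_continuous sAB sW)
  have int: "integrable lborel (\<lambda>p::plane. A (snd p) * (?U (fst p))\<^sup>2)"
  proof (rule lborel_integrable_of_compact_support[OF ci K])
    show "A (snd p) * (?U (fst p))\<^sup>2 = 0" if "p \<notin> ?K" for p
      using that U deriv_step_eq_0 by (cases p) (auto simp: A_def bump_def)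
  qed
  have "pairing W (step_form ?U) = (LINT p|lborel. ?g p (1,0) - 2 * (A (snd p) * (?U (fst p))\<^sup>2))"
    unfolding pairing_def
    by (intro Bochner_Integration.integral_cong refl)
       (simp add: wedge11_def step_form_def A_def B_def dB algebra_simps power2_eq_square)
  also have "\<dots> = - 2 * (LINT p|lborel. A (snd p) * (?U (fst p))\<^sup>2)"
    using g int by (subst Bochner_Integration.integral_diff) auto
  also have "(LINT p|lborel. A (snd p) * (?U (fst p))\<^sup>2) = (LINT y|lborel. (?U y)\<^sup>2) / 2"
  proof -
    have "(LINT p|lborel. A (snd p) * (?U (fst p))\<^sup>2) = (LINT y|lborel. LINT z|lborel. A z * (?U y)\<^sup>2)"
      using lborel_pair.integral_fst'[of "\<lambda>p. A (snd p) * (?U (fst p))\<^sup>2"] int by (simp add: lborel_prod)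
    also have "\<dots> = (LINT y|lborel. (1 / 2) * (?U y)\<^sup>2)"
      unfolding integral_mult_left_zero by (simp add: A_def integral_step_times_deriv)
    finally show ?thesis by simp
  qed
  finally show ?thesis using integral_deriv_squared_pos[OF W ne] by simp
qed

end

section \<open>Infinite dimension from a biorthogonal family\<close>

text \<open>
  Applying \<open>t j\<close> to a linear relation among the \<open>q i\<close> isolates the coefficient of \<open>q j\<close>, so the
  \<open>q i\<close> form an infinite linearly independent set.
\<close>
lemma not_fin_dim_of_functionals:
  fixes V :: "(real, 'm, 'x) module_scheme" and q :: "nat \<Rightarrow> 'm" and t :: "nat \<Rightarrow> 'm \<Rightarrow> real"
  assumes V: "vectorspace real_field V"
    and q: "\<And>i. q i \<in> carrier V"
    and add: "\<And>j x y. x \<in> carrier V \<Longrightarrow> y \<in> carrier V \<Longrightarrow> t j (x \<oplus>\<^bsub>V\<^esub> y) = t j x + t j y"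
    and smult: "\<And>j c x. x \<in> carrier V \<Longrightarrow> t j (c \<odot>\<^bsub>V\<^esub> x) = c * t j x"
    and dual: "\<And>i j. t j (q i) = (0::real) \<longleftrightarrow> i \<noteq> j"
  shows "\<not> vectorspace.fin_dim real_field V"
proof
  interpret vectorspace real_field V by (rule V)
  assume fin: "fin_dim"
  have K_simps: "carrier real_field = UNIV" "zero real_field = 0" by (simp_all add: real_field_def)
  have t_zero: "t j \<zero>\<^bsub>V\<^esub> = 0" for j
    using add[of "\<zero>\<^bsub>V\<^esub>" "\<zero>\<^bsub>V\<^esub>" j] by simp
  have t_lincomb: "t j (lincomb a A) = (\<Sum>v\<in>A. a v * t j v)"
    if "finite A" "A \<subseteq> carrier V" for j a A
  proof -
    have "t j (finsum V (\<lambda>v. a v \<odot>\<^bsub>V\<^esub> v) A) = (\<Sum>v\<in>A. a v * t j v)"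
      using that
    proof (induction A rule: finite_induct)
      case (insert v A)
      have closed: "a u \<odot>\<^bsub>V\<^esub> u \<in> carrier V" if "u \<in> carrier V" for u
        using that by (intro smult_closed) (simp_all add: K_simps)
      then have *: "(\<lambda>v. a v \<odot>\<^bsub>V\<^esub> v) \<in> A \<rightarrow> carrier V" using insert.prems by auto
      show ?case
        using insert.hyps insert.prems insert.IH closed[of v] *
        by (simp add: finsum_insert[OF insert.hyps(1,2) *] add smult finsum_closed[OF *])
    qed (simp add: t_zero)
    then show ?thesis by (simp add: lincomb_def)
  qed
  have "lin_indpt (range q)"
  proof
    assume "lin_dep (range q)"
    then obtain A a v where A: "finite A" "A \<subseteq> range q" "lincomb a A = \<zero>\<^bsub>V\<^esub>" "v \<in> A" "a v \<noteq> 0"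
      unfolding lin_dep_def K_simps by blast
    then obtain j where j: "v = q j" by blast
    have "(\<Sum>u\<in>A. a u * t j u) = t j (lincomb a A)"
      using A(1,2) q by (intro t_lincomb[symmetric]) auto
    also have "\<dots> = 0" by (simp add: A(3) t_zero)
    finally have "(\<Sum>u\<in>A. a u * t j u) = 0" .
    moreover have "a u * t j u = 0" if "u \<in> A - {v}" for u
      using that A(2) j dual by auto
    then have "(\<Sum>u\<in>A - {v}. a u * t j u) = 0" by (rule sum.neutral[rule_format])
    then have "(\<Sum>u\<in>A. a u * t j u) = a v * t j v"
      using sum.remove[OF A(1,4), of "\<lambda>u. a u * t j u"] by simp
    ultimately show False using A(5) dual[of j j] by (simp add: j K_simps)
  qed
  moreover have "infinite (range q)"
  proof (rule range_inj_infinite, rule injI)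
    fix i j assume "q i = q j"
    then have "t i (q j) \<noteq> 0" using dual[of i i] by simp
    then show "i = j" using dual[of i j] by blast
  qed
  ultimately show False
    using fin_dim_li_fin[OF fin, of "range q"] q by blast
qed

text \<open>
  The functionals live on a space \<open>L\<close> that contains both \<open>Z\<close> and \<open>W\<close>: they need to be additive on
  sums of an element of \<open>Z\<close> and one of \<open>W\<close> in order to descend to cosets.
\<close>
lemma quotient_not_fin_dim:
  fixes Z W L :: "('a \<Rightarrow> 'v::real_vector) set" and T :: "nat \<Rightarrow> ('a \<Rightarrow> 'v) \<Rightarrow> real"
  assumes Z: "lin_closed Z" and W: "lin_closed W" and L: "Z \<subseteq> L" "W \<subseteq> L"
    and add: "\<And>j x y. x \<in> L \<Longrightarrow> y \<in> L \<Longrightarrow> T j (\<lambda>p. x p + y p) = T j x + T j y"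
    and scale: "\<And>j c x. x \<in> L \<Longrightarrow> T j (\<lambda>p. c *\<^sub>R x p) = c * T j x"
    and vanish: "\<And>j x. x \<in> W \<Longrightarrow> T j x = 0"
    and \<omega>: "\<And>i. \<omega> i \<in> Z" and dual: "\<And>i j. T j (\<omega> i) = 0 \<longleftrightarrow> i \<noteq> j"
  shows "\<not> vectorspace.fin_dim real_field (quotient_module (function_module Z) W)"
proof -
  let ?F = "function_module Z" let ?Q = "quotient_module ?F W"
  define q where "q x = a_r_coset ?F W x" for x
  define t where "t j C = T j (SOME x. x \<in> C)" for j C
  have car: "carrier ?Q = q ` Z"
    unfolding quotient_module_def q_def by (auto simp: A_RCOSETS_def' function_module_def)
  have ad: "x \<oplus>\<^bsub>?Q\<^esub> y = q (\<lambda>p. x' p + y' p)" if "x = q x'" "y = q y'" for x y x' y'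
    using coset_add[OF W, of Z x' y'] that by (simp add: q_def quotient_module_def)
  have sm: "c \<odot>\<^bsub>?Q\<^esub> x = q (\<lambda>p. c *\<^sub>R x' p)" if "x = q x'" for x x' c
    using coset_smult[OF W, where S=Z and x=x' and c=c] that
    by (simp add: q_def quotient_module_def) (simp add: function_module_def)
  have t: "t j (q x) = T j x" if "x \<in> Z" for j x
  proof -
    have "x \<in> q x" using W by (simp add: q_def in_coset lin_closed_def)
    then have "(SOME y. y \<in> q x) \<in> q x" by (rule someI[of "\<lambda>y. y \<in> q x"])
    then obtain h where h: "h \<in> W" "(SOME y. y \<in> q x) = (\<lambda>p. h p + x p)"
      unfolding q_def coset_eq by blast
    then show ?thesis
      using add[of h x j] vanish[of h j] that L by (auto simp: t_def)
  qed
  show ?thesis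
  proof (rule not_fin_dim_of_functionals[OF vs_quot[OF Z W], of "\<lambda>i. q (\<omega> i)" t])
    show "t j (x \<oplus>\<^bsub>?Q\<^esub> y) = t j x + t j y" if xy: "x \<in> carrier ?Q" "y \<in> carrier ?Q" for j x y
    proof -
      obtain x' y' where *: "x' \<in> Z" "y' \<in> Z" "x = q x'" "y = q y'" using xy car by auto
      have "t j (x \<oplus>\<^bsub>?Q\<^esub> y) = T j (\<lambda>p. x' p + y' p)"
        by (simp only: ad[OF *(3,4)] t[OF lin_add[OF Z *(1,2)]])
      also have "\<dots> = T j x' + T j y'" using * L by (intro add) auto
      finally show ?thesis by (simp only: *(3,4) t[OF *(1)] t[OF *(2)])
    qed
    show "t j (c \<odot>\<^bsub>?Q\<^esub> x) = c * t j x" if x: "x \<in> carrier ?Q" for j c x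
    proof -
      obtain x' where *: "x' \<in> Z" "x = q x'" using x car by auto
      have "t j (c \<odot>\<^bsub>?Q\<^esub> x) = T j (\<lambda>p. c *\<^sub>R x' p)"
        by (simp only: sm[OF *(2)] t[OF lin_smult[OF Z *(1)]])
      also have "\<dots> = c * T j x'" using * L by (intro scale) auto
      finally show ?thesis by (simp only: *(2) t[OF *(1)])
    qed
  qed (use \<omega> dual t car in auto)
qed

section \<open>The reduced cohomology of the hyperbolic plane\<close>

theorem theorem5p3:
  fixes \<Phi>1 \<Phi>2 \<Psi>1 \<Psi>2 :: "real \<Rightarrow> real"
  assumes "N_function \<Phi>1" and "N_function \<Phi>2"
    and "\<Psi>1 = complementary \<Phi>1" and "\<Psi>2 = complementary \<Phi>2"
    and "(\<integral>\<^sup>+v\<in>{0<..1}. ennreal (\<Psi>1 v / v\<^sup>2) \<partial>lborel) < \<infinity>"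
    and "(\<integral>\<^sup>+v\<in>{0<..1}. ennreal (\<Psi>2 v / v\<^sup>2) \<partial>lborel) < \<infinity>"
    and "(\<integral>\<^sup>+v\<in>{0<..1}. ennreal (\<Phi>2 v / v\<^sup>2) \<partial>lborel) < \<infinity>"
  shows "\<not> vectorspace.fin_dim real_field (reduced_cohomology1 hyperbolic_metric \<Phi>1 \<Phi>2)"
proof -
  note N = assms(1,2)
  note fin = assms(5,6)[unfolded assms(3,4)] assms(7)
  obtain \<sigma> :: "real \<Rightarrow> real" where \<sigma>: "smooth \<sigma>" "\<And>z. z \<le> 0 \<Longrightarrow> \<sigma> z = 0" "\<And>z. 1 \<le> z \<Longrightarrow> \<sigma> z = 1"
    by (rule smooth_step_exists) blast
  interpret smooth_step \<sigma> using \<sigma> by unfold_locales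
  obtain y\<^sub>0 where y\<^sub>0: "deriv \<sigma> y\<^sub>0 \<noteq> 0"
  proof (rule ccontr)
    assume "\<not> thesis"
    then have "\<forall>y. deriv \<sigma> y = 0" using that by blast
    then have "\<sigma> 0 = \<sigma> 1"
      using smooth_real_has_derivative[OF \<sigma>(1)] by (intro DERIV_isconst_all) simp
    then show False using \<sigma>(2)[of 0] \<sigma>(3)[of 1] by simp
  qed
  \<comment> \<open>A step of 2 keeps the supports \<open>[2i, 2i + 1]\<close> disjoint.\<close>
  define W where "W i y = deriv \<sigma> (y + - (2 * real i))" for i :: nat and y
  have W: "bump (2 * real i) (2 * real i + 1) (W i)" for i
  proof -
    have "Ck k (\<lambda>y. deriv \<sigma> (y + - (2 * real i)))" for k
      using smooth_deriv[OF \<sigma>(1)] unfolding smooth_def by (intro Ck_translate) simp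
    then have "smooth (W i)" unfolding smooth_def W_def[abs_def] by blast
    then show ?thesis using deriv_step_eq_0 by (auto simp: bump_def W_def)
  qed
  have W_neq_0: "W i (y\<^sub>0 + 2 * real i) \<noteq> 0" for i using y\<^sub>0 by (simp add: W_def)
  let ?\<omega> = "\<lambda>i. step_form (deriv (W i))"
  show ?thesis
    unfolding reduced_cohomology1_def
  proof (rule quotient_not_fin_dim[where L = "L1 hyperbolic_metric \<Phi>2" and T = "\<lambda>j. pairing (W j)" and \<omega> = ?\<omega>])
    show "lin_closed (Z1 hyperbolic_metric \<Phi>2)" by (rule lin_Z1[OF N(2)])
    show "lin_closed (B1_closure hyperbolic_metric \<Phi>1 \<Phi>2)"
      unfolding B1_closure_def by (intro lin_closure_L1 lin_B1 N) (auto simp: B1_def)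
    show "Z1 hyperbolic_metric \<Phi>2 \<subseteq> L1 hyperbolic_metric \<Phi>2" by (auto simp: Z1_def)
    show "B1_closure hyperbolic_metric \<Phi>1 \<Phi>2 \<subseteq> L1 hyperbolic_metric \<Phi>2" by (auto simp: B1_closure_def)
    show "pairing (W j) (\<lambda>p. x p + y p) = pairing (W j) x + pairing (W j) y"
      if "x \<in> L1 hyperbolic_metric \<Phi>2" "y \<in> L1 hyperbolic_metric \<Phi>2" for j x y
      by (rule pairing_add[OF N(2) fin(2) smooth_step_axioms W that])
    show "pairing (W j) (\<lambda>p. c *\<^sub>R x p) = c * pairing (W j) x" for j c x
      by (rule pairing_scaleR)
    show "pairing (W j) x = 0" if "x \<in> B1_closure hyperbolic_metric \<Phi>1 \<Phi>2" for j x
      by (rule pairing_eq_0_of_closure[OF W N fin(1,2) that])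
    show "?\<omega> i \<in> Z1 hyperbolic_metric \<Phi>2" for i
      using step_form_L1[OF bump_deriv[OF W] N(2) fin(3)] step_form_closed[OF bump_deriv[OF W]]
      by (simp add: Z1_def)
    show "pairing (W j) (?\<omega> i) = 0 \<longleftrightarrow> i \<noteq> j" for i j
    proof (cases "i = j")
      case True
      then show ?thesis using pairing_deriv_neq_0[OF W W_neq_0] by simp
    next
      case False
      then have "2 * real i + 1 < 2 * real j \<or> 2 * real j + 1 < 2 * real i" by linarith
      then show ?thesis using pairing_eq_0_of_disjoint[OF bump_deriv[OF W] W] False by blast
    qed
  qed
qed

end
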